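(* Let $q$ be a prime power and $n\geq 2$ an integer. Let $\mathcal{S}=(\mathcal{P},\mathcal{B},I)$ be the incidence structure defined in the context: its points are the orbits on $AG(n,q^2)$ of the group $N$; its blocks are the images under the group $G$ of the affine Hermitian variety $X_1^{q+1}+\cdots+X_{n-1}^{q+1}+X_n^q+X_n=0$ together with the images under $G$ of the affine Hermitian cones $\sum_{s=1}^{n-1}(\omega_s^qX_s^q-\omega_sX_s)=0$, with $(\omega_1,\ldots,\omega_{n-1})\in\mathrm{GF}(q^2)^{n-1}\setminus\{(0,\ldots,0)\}$; incidence is inclusion. Then $\mathcal{S}$ is an affine $$2-\left(q^{2n-1},\,q^{2(n-1)},\,q^{2n-3}+\cdots+q+1\right)$$ design and, for $q>2$, $\mathcal{S}$ is isomorphic to the point--hyperplane design of the affine space $AG(2n-1,q)$.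
   Context: Setting: $PG(n,q^2)$ has homogeneous coordinates $(X_1,\ldots,X_{n+1})$; $AG(n,q^2)$ is the complement of the hyperplane $X_{n+1}=0$, and an affine point $(x_1,\ldots,x_n)$ corresponds to $(x_1,\ldots,x_n,1)$. The trace is $\mathrm{tr}:\mathrm{GF}(q^2)\to\mathrm{GF}(q)$, $\mathrm{tr}(x)=x^q+x$, and $T_0=\{t\in\mathrm{GF}(q^2):\mathrm{tr}(t)=0\}$. The group $G$: it is the subgroup of $PGL(n+1,q^2)$ consisting of all collineations given, up to a non-zero scalar, by $(X'_1,\ldots,X'_{n+1})=(X_1,\ldots,X_{n+1})D^{-1}$, where, for arbitrary $i_1,\ldots,i_n,j_1,\ldots,j_{n-1}\in\mathrm{GF}(q^2)$, $$D=\begin{pmatrix}1&0&\cdots&0&j_1&0\\0&1&\cdots&0&j_2&0\\\vdots&&\ddots&&\vdots&\vdots\\0&0&\cdots&1&j_{n-1}&0\\0&0&\cdots&0&1&0\\i_1&i_2&\cdots&i_{n-1}&i_n&1\end{pmatrix}.$$ $G$ fixes the hyperplane $X_{n+1}=0$ and so acts on $AG(n,q^2)$. The group $N$: it is the subgroup of $G$ given by $i_1=\cdots=i_{n-1}=j_1=\cdots=j_{n-1}=0$ and $i_n\in T_0$. The $N$-orbit of an affine point is $N(x_1,\ldots,x_n)=\{(x_1,\ldots,x_{n-1},x_n+r):r\in T_0\}$. The incidence structure $\mathcal{S}=(\mathcal{P},\mathcal{B},I)$: $\mathcal{P}$ is the set of all $N$-orbits of points of $AG(n,q^2)$. $\mathcal{B}$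 is the set of all subsets of $AG(n,q^2)$ that are images, under elements of $G$, either of the set of affine points satisfying $X_1^{q+1}+\cdots+X_{n-1}^{q+1}+X_n^q+X_n=0$, or of the set of affine points satisfying $\sum_{s=1}^{n-1}(\omega_s^qX_s^q-\omega_sX_s)=0$ for some non-zero $(\omega_1,\ldots,\omega_{n-1})\in\mathrm{GF}(q^2)^{n-1}$. A point $P\in\mathcal{P}$ is incident with a block $B\in\mathcal{B}$ if and only if $P\subseteq B$. Designs: a $2-(v,k,\lambda)$ design has $v$ points, every block is incident with exactly $k$ points, and any two distinct points are incident with exactly $\lambda$ common blocks. Two blocks are parallel if they are equal or disjoint (as sets of points). The $2$-design $\mathcal{S}$ is affine if (a) any two distinct blocks are either disjoint or have a constant number of points in common (here $q^{2n-3}$), and (b) for each point $P$ and each block $B$ with $P\notin B$ there is a unique block $B'$ with $P\in B'$ and $B\cap B'=\emptyset$. The point--hyperplane design of $AG(m,q)$ has the points of $AG(m,q)$ as points and the affine hyperplanes as blocks. *)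

theory Defs
  imports
    "Jordan_Normal_Form.Matrix"
    "HOL-Number_Theory.Prime_Powers"
    "HOL-Library.FuncSet"
begin

record ('p, 'b) inc_struct =
  points :: "'p set"
  blocks :: "'b set"
  inc :: "'p \<Rightarrow> 'b \<Rightarrow> bool"

definition block_points :: "('p, 'b) inc_struct \<Rightarrow> 'b \<Rightarrow> 'p set" where
  "block_points S b = {p \<in> points S. inc S p b}"

definition two_design :: "('p, 'b) inc_struct \<Rightarrow> nat \<Rightarrow> nat \<Rightarrow> nat \<Rightarrow> bool" where
  "two_design S v k l \<longleftrightarrow>
     finite (points S) \<and> finite (blocks S) \<and>
     card (points S) = v \<and>
     (\<forall>b\<in>blocks S. card (block_points S b) = k) \<and>
     (\<forall>p\<in>points S. \<forall>p'\<in>points S. p \<noteq> p' \<longrightarrow>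
        card {b \<in> blocks S. inc S p b \<and> inc S p' b} = l)"

text \<open>Here \<open>\<mu>\<close> is the constant number of common points of two distinct non-disjoint blocks.\<close>

definition affine_two_design ::
    "('p, 'b) inc_struct \<Rightarrow> nat \<Rightarrow> nat \<Rightarrow> nat \<Rightarrow> nat \<Rightarrow> bool" where
  "affine_two_design S v k l \<mu> \<longleftrightarrow>
     two_design S v k l \<and>
     (\<forall>b\<in>blocks S. \<forall>b'\<in>blocks S. b \<noteq> b' \<longrightarrow>
        block_points S b \<inter> block_points S b' = {} \<or>
        card (block_points S b \<inter> block_points S b') = \<mu>) \<and>
     (\<forall>p\<in>points S. \<forall>b\<in>blocks S. \<not> inc S p b \<longrightarrow>
        (\<exists>!b'. b' \<in> blocks S \<and> inc S p b' \<and> block_points S b \<inter> block_points S b' = {}))"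

definition isomorphic :: "('p, 'b) inc_struct \<Rightarrow> ('p2, 'b2) inc_struct \<Rightarrow> bool" where
  "isomorphic S T \<longleftrightarrow>
     (\<exists>f g. bij_betw f (points S) (points T) \<and> bij_betw g (blocks S) (blocks T) \<and>
        (\<forall>p\<in>points S. \<forall>b\<in>blocks S. inc S p b \<longleftrightarrow> inc T (f p) (g b)))"

text \<open>If \<^typ>\<open>'a\<close> has \<open>q\<^sup>2\<close> elements, this is its unique subfield of order \<open>q\<close>.\<close>

definition GFq :: "nat \<Rightarrow> 'a::field set" where
  "GFq q = {x. x ^ q = x}"

definition AGq_points :: "nat \<Rightarrow> nat \<Rightarrow> 'a::field vec set" where
  "AGq_points q m = {x \<in> carrier_vec m. \<forall>s<m. x $ s \<in> GFq q}"

definition AGq_hyperplanes :: "nat \<Rightarrow> nat \<Rightarrow> 'a::field vec set set" where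
  "AGq_hyperplanes q m =
     {{x \<in> AGq_points q m. a \<bullet> x = c} | a c. a \<in> AGq_points q m \<and> a \<noteq> 0\<^sub>v m \<and> c \<in> GFq q}"

definition AGq_design :: "nat \<Rightarrow> nat \<Rightarrow> ('a::field vec, 'a vec set) inc_struct" where
  "AGq_design q m = \<lparr>points = AGq_points q m, blocks = AGq_hyperplanes q m, inc = (\<in>)\<rparr>"

text \<open>Coordinates are indexed from 0: the coordinate \<open>X\<^sub>s\<close> of the usual notation is \<open>X $ (s - 1)\<close>,
  so that \<open>X\<^sub>n\<close> is \<open>X $ (n - 1)\<close> and \<open>X\<^sub>n\<^sub>+\<^sub>1\<close>, whose vanishing defines the hyperplane at infinity,
  is \<open>X $ n\<close>. A projective point is the set of all its homogeneous coordinate vectors.\<close>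

definition proj_point :: "'a::field vec \<Rightarrow> 'a vec set" where
  "proj_point X = {c \<cdot>\<^sub>v X | c. c \<noteq> 0}"

definition PG :: "nat \<Rightarrow> 'a::field vec set set" where
  "PG n = {proj_point X | X. X \<in> carrier_vec (n + 1) \<and> X \<noteq> 0\<^sub>v (n + 1)}"

definition AG :: "nat \<Rightarrow> 'a vec set" where
  "AG n = carrier_vec n"

definition homog :: "'a::field vec \<Rightarrow> 'a vec set" where
  "homog x = proj_point (x @\<^sub>v vec 1 (\<lambda>_. 1))"

text \<open>The collineation \<open>X \<mapsto> X A\<close>, with \<open>X\<close> a row vector, i.e. \<open>A\<^sup>T\<close> times a column vector.\<close>

definition collineation :: "nat \<Rightarrow> 'a::field mat \<Rightarrow> 'a vec set \<Rightarrow> 'a vec set" where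
  "collineation n A = restrict (\<lambda>P. (\<lambda>X. transpose_mat A *\<^sub>v X) ` P) (PG n)"

definition affine_image ::
    "nat \<Rightarrow> ('a::field vec set \<Rightarrow> 'a vec set) \<Rightarrow> 'a vec set \<Rightarrow> 'a vec set" where
  "affine_image n g B = {y \<in> AG n. homog y \<in> g ` homog ` B}"

definition tr :: "nat \<Rightarrow> 'a::field \<Rightarrow> 'a" where
  "tr q x = x ^ q + x"

definition T0 :: "nat \<Rightarrow> 'a::field set" where
  "T0 q = {t. tr q t = 0}"

definition Dmat :: "nat \<Rightarrow> 'a::field vec \<Rightarrow> 'a vec \<Rightarrow> 'a mat" where
  "Dmat n i j = mat (n + 1) (n + 1) (\<lambda>(r, c).
     if r = c then 1
     else if r = n then i $ c
     else if c = n - 1 then j $ r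
     else 0)"

definition is_inverse_mat :: "nat \<Rightarrow> 'a::field mat \<Rightarrow> 'a mat \<Rightarrow> bool" where
  "is_inverse_mat m M A \<longleftrightarrow> A \<in> carrier_mat m m \<and> inverts_mat M A \<and> inverts_mat A M"

definition group_G :: "nat \<Rightarrow> ('a::field vec set \<Rightarrow> 'a vec set) set" where
  "group_G n = {collineation n A | A i j.
     i \<in> carrier_vec n \<and> j \<in> carrier_vec (n - 1) \<and> is_inverse_mat (n + 1) (Dmat n i j) A}"

definition group_N :: "nat \<Rightarrow> nat \<Rightarrow> ('a::field vec set \<Rightarrow> 'a vec set) set" where
  "group_N q n = {collineation n A | A i.
     i \<in> carrier_vec n \<and> (\<forall>s<n - 1. i $ s = 0) \<and> i $ (n - 1) \<in> T0 q \<and>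
     is_inverse_mat (n + 1) (Dmat n i (0\<^sub>v (n - 1))) A}"

definition N_orbit :: "nat \<Rightarrow> nat \<Rightarrow> 'a::field vec \<Rightarrow> 'a vec set" where
  "N_orbit q n x = {y \<in> AG n. \<exists>g\<in>group_N q n. homog y = g (homog x)}"

definition hermitian_variety :: "nat \<Rightarrow> nat \<Rightarrow> 'a::field vec set" where
  "hermitian_variety q n =
     {x \<in> AG n. (\<Sum>s<n - 1. (x $ s) ^ (q + 1)) + (x $ (n - 1)) ^ q + x $ (n - 1) = 0}"

definition hermitian_cone :: "nat \<Rightarrow> nat \<Rightarrow> 'a::field vec \<Rightarrow> 'a vec set" where
  "hermitian_cone q n \<omega> =
     {x \<in> AG n. (\<Sum>s<n - 1. (\<omega> $ s) ^ q * (x $ s) ^ q - \<omega> $ s * x $ s) = 0}"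

definition S_struct :: "nat \<Rightarrow> nat \<Rightarrow> ('a::field vec set, 'a vec set) inc_struct" where
  "S_struct q n =
     \<lparr>points = N_orbit q n ` AG n,
      blocks = {affine_image n g (hermitian_variety q n) | g. g \<in> group_G n} \<union>
               {affine_image n g (hermitian_cone q n \<omega>) | g \<omega>.
                  g \<in> group_G n \<and> \<omega> \<in> carrier_vec (n - 1) \<and> \<omega> \<noteq> 0\<^sub>v (n - 1)},
      inc = (\<subseteq>)\<rparr>"

end

theory Submission
  imports Defs "Jordan_Normal_Form.Determinant" "HOL-Computational_Algebra.Polynomial" "HOL-Number_Theory.Residues" "HOL-Library.Product_Plus"
begin

text \<open>
  Write \<open>K\<close> for the subfield of order \<open>q\<close> and \<open>Q(y) = \<Sum>\<^sub>s N(y\<^sub>s) + Tr(y\<^sub>n)\<close>, the sum being over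
  \<open>s < n\<close>. The map \<open>y \<mapsto> (y\<^sub>1, \<dots>, y\<^sub>n\<^sub>-\<^sub>1, Q(y))\<close> has exactly the \<open>N\<close>-orbits as fibres, and its
  target is a \<open>K\<close>-space of dimension \<open>2n - 1\<close>. The images of the Hermitian variety under \<open>G\<close> are
  the sets \<open>Q(y) + Tr(\<Sum>\<^sub>s b\<^sub>s y\<^sub>s) = c\<close>, i.e. the preimages of the hyperplanes involving the last
  coordinate; multiplying the equation of a cone by an \<open>\<epsilon>\<close> with \<open>\<epsilon>\<^sup>q = - \<epsilon>\<close> turns it into
  \<open>Tr(\<epsilon> \<Sum>\<^sub>s \<omega>\<^sub>s y\<^sub>s) = 0\<close>, so the images of the cones are the preimages of the remaining hyperplanes.
  Hence \<open>\<S>\<close> is isomorphic to the point-hyperplane design for every \<open>q\<close>, and the design parameters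
  can be computed there.
\<close>

section \<open>Isomorphisms of incidence structures\<close>

text \<open>Each clause is a cardinality or disjointness statement about sets of points or blocks.
  Since \<open>f\<close> maps the points of a block \<open>b\<close> exactly onto those of
  \<open>g b\<close> and is injective, it also respects intersections, so every clause pulls
  back.\<close>

lemma affine_two_design_isomorphic:
  assumes "isomorphic S T" and "affine_two_design T v k l \<mu>"
  shows "affine_two_design S v k l \<mu>"
proof -
  obtain f g where f: "bij_betw f (points S) (points T)"
    and g: "bij_betw g (blocks S) (blocks T)"
    and fg: "\<And>p b. p \<in> points S \<Longrightarrow> b \<in> blocks S \<Longrightarrow> inc S p b \<longleftrightarrow> inc T (f p) (g b)"
    using assms(1) unfolding isomorphic_def by blast
  have T: "finite (points T)" "finite (blocks T)" "card (points T) = v"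
    and T_block: "\<And>b. b \<in> blocks T \<Longrightarrow> card (block_points T b) = k"
    and T_pair: "\<And>p p'. p \<in> points T \<Longrightarrow> p' \<in> points T \<Longrightarrow> p \<noteq> p' \<Longrightarrow>
      card {b \<in> blocks T. inc T p b \<and> inc T p' b} = l"
    and T_meet: "\<And>b b'. b \<in> blocks T \<Longrightarrow> b' \<in> blocks T \<Longrightarrow> b \<noteq> b' \<Longrightarrow>
      block_points T b \<inter> block_points T b' = {} \<or> card (block_points T b \<inter> block_points T b') = \<mu>"
    and T_par: "\<And>p b. p \<in> points T \<Longrightarrow> b \<in> blocks T \<Longrightarrow> \<not> inc T p b \<Longrightarrow>
      \<exists>!b'. b' \<in> blocks T \<and> inc T p b' \<and> block_points T b \<inter> block_points T b' = {}"
    using assms(2) by (simp_all add: affine_two_design_def two_design_def)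
  have fp: "f p \<in> points T" if "p \<in> points S" for p
    using f that by (auto simp: bij_betw_def)
  have gb: "g b \<in> blocks T" if "b \<in> blocks S" for b
    using g that by (auto simp: bij_betw_def)
  have f_inj: "inj_on f (points S)" and f_surj: "f ` points S = points T"
    using f by (auto simp: bij_betw_def)
  have g_inj: "inj_on g (blocks S)" and g_surj: "g ` blocks S = blocks T"
    using g by (auto simp: bij_betw_def)
  have sub: "block_points S b \<subseteq> points S" for b
    by (auto simp: block_points_def)
  have img: "f ` block_points S b = block_points T (g b)" if "b \<in> blocks S" for b
  proof -
    have "f ` block_points S b = f ` {p \<in> points S. inc T (f p) (g b)}"
      using that fg by (auto simp: block_points_def)
    also have "\<dots> = {p \<in> f ` points S. inc T p (g b)}"
      by auto
    finally show ?thesis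
      by (simp add: f_surj block_points_def)
  qed
  have img_int: "f ` (block_points S b \<inter> block_points S b') = block_points T (g b) \<inter> block_points T (g b')"
    if "b \<in> blocks S" "b' \<in> blocks S" for b b'
    using that inj_on_image_Int[OF f_inj sub sub] img by simp
  have card_img: "card (f ` A) = card A" if "A \<subseteq> points S" for A
    using that f_inj by (meson card_image inj_on_subset)
  have "card {b \<in> blocks S. inc S p b \<and> inc S p' b} = l"
    if "p \<in> points S" "p' \<in> points S" "p \<noteq> p'" for p p'
  proof -
    have "g ` {b \<in> blocks S. inc S p b \<and> inc S p' b}
        = {b \<in> blocks T. inc T (f p) b \<and> inc T (f p') b}"
      unfolding g_surj[symmetric] using fg that by auto
    then have "card {b \<in> blocks S. inc S p b \<and> inc S p' b}
        = card {b \<in> blocks T. inc T (f p) b \<and> inc T (f p') b}"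
      by (metis (no_types, lifting) card_image g_inj inj_on_subset mem_Collect_eq subsetI)
    also have "\<dots> = l"
      using that f_inj by (intro T_pair fp) (auto dest: inj_onD)
    finally show ?thesis .
  qed
  moreover have "finite (points S)" "finite (blocks S)" "card (points S) = v"
    using T bij_betw_finite[OF f] bij_betw_finite[OF g] bij_betw_same_card[OF f] by simp_all
  moreover have "card (block_points S b) = k" if "b \<in> blocks S" for b
    using T_block[OF gb[OF that]] img[OF that] card_img[OF sub, of b] by simp
  moreover have "block_points S b \<inter> block_points S b' = {} \<or>
      card (block_points S b \<inter> block_points S b') = \<mu>"
    if "b \<in> blocks S" "b' \<in> blocks S" "b \<noteq> b'" for b b'
  proof -
    have "g b \<noteq> g b'"
      using that g_inj by (auto dest: inj_onD)
    then have "block_points T (g b) \<inter> block_points T (g b') = {} \<or>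
      card (block_points T (g b) \<inter> block_points T (g b')) = \<mu>"
      using that by (intro T_meet gb)
    moreover have "card (f ` (block_points S b \<inter> block_points S b')) =
        card (block_points S b \<inter> block_points S b')"
      using sub by (intro card_img) blast
    ultimately show ?thesis
      unfolding img_int[OF that(1,2), symmetric] by auto
  qed
  moreover have "\<exists>!b'. b' \<in> blocks S \<and> inc S p b' \<and> block_points S b \<inter> block_points S b' = {}"
    if pb: "p \<in> points S" "b \<in> blocks S" "\<not> inc S p b" for p b
  proof -
    have disj: "block_points S b \<inter> block_points S b' = {} \<longleftrightarrow>
        block_points T (g b) \<inter> block_points T (g b') = {}" if "b' \<in> blocks S" for b'
      unfolding img_int[OF pb(2) that, symmetric] by simp
    \<comment> \<open>The parallel block is found in \<open>T\<close> and pulled back along the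
      bijection \<open>g\<close>; injectivity of \<open>g\<close> then gives uniqueness.\<close>
    have ex1: "\<exists>!b'. b' \<in> blocks T \<and> inc T (f p) b' \<and> block_points T (g b) \<inter> block_points T b' = {}"
      using pb fg by (intro T_par fp gb) auto
    then obtain c where c: "c \<in> blocks S" "inc T (f p) (g c)"
        "block_points T (g b) \<inter> block_points T (g c) = {}"
      unfolding g_surj[symmetric] by auto
    show ?thesis
    proof (intro ex1I[of _ c] conjI)
      fix b' assume b': "b' \<in> blocks S \<and> inc S p b' \<and> block_points S b \<inter> block_points S b' = {}"
      then have "inc T (f p) (g b')" "block_points T (g b) \<inter> block_points T (g b') = {}"
        using disj fg pb by auto
      then have "g b' = g c"
        using ex1 c b' gb by blast
      then show "b' = c"
        using g_inj b' c by (auto dest: inj_onD)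
    qed (use c disj fg pb in auto)
  qed
  ultimately show ?thesis
    unfolding affine_two_design_def two_design_def by auto
qed

text \<open>A fibre of \<open>\<Psi>\<close> lies inside a full preimage exactly when its common
  value lies in the block, so inclusion becomes membership. Surjectivity recovers each block
  \<open>H\<close> as the image of its preimage.\<close>

lemma isomorphic_pullback:
  assumes surj: "\<Psi> ` X = points T"
    and T_inc: "inc T = (\<in>)" and T_blocks: "\<And>H. H \<in> blocks T \<Longrightarrow> H \<subseteq> points T"
    and S_points: "points S = (\<lambda>x. {y \<in> X. \<Psi> y = \<Psi> x}) ` X"
    and S_blocks: "blocks S = (\<lambda>H. {y \<in> X. \<Psi> y \<in> H}) ` blocks T"
    and S_inc: "inc S = (\<subseteq>)"
  shows "isomorphic S T"
proof -
  \<comment> \<open>\<open>\<Psi>\<close> is constant on a fibre, so \<open>the_elem\<close> reads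
    off its value.\<close>
  define f where "f P = the_elem (\<Psi> ` P)" for P
  have f: "f {y \<in> X. \<Psi> y = \<Psi> x} = \<Psi> x" if "x \<in> X" for x
  proof -
    have "\<Psi> ` {y \<in> X. \<Psi> y = \<Psi> x} = {\<Psi> x}"
      using that by auto
    then show ?thesis
      by (simp add: f_def)
  qed
  have g: "\<Psi> ` {y \<in> X. \<Psi> y \<in> H} = H" if "H \<in> blocks T" for H
  proof -
    have "H \<subseteq> \<Psi> ` X"
      using T_blocks[OF that] surj by simp
    then show ?thesis
      by blast
  qed
  have "bij_betw f (points S) (points T)"
    unfolding bij_betw_def
  proof
    show "inj_on f (points S)"
      unfolding S_points by (rule inj_onI) (auto simp: f)
    show "f ` points S = points T"
      unfolding S_points image_image surj[symmetric] by (rule image_cong) (auto simp: f)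
  qed
  moreover have "bij_betw ((`) \<Psi>) (blocks S) (blocks T)"
    unfolding bij_betw_def
  proof
    show "inj_on ((`) \<Psi>) (blocks S)"
      unfolding S_blocks by (rule inj_onI) (auto simp: g)
    show "(`) \<Psi> ` blocks S = blocks T"
      unfolding S_blocks image_image by (simp add: g)
  qed
  moreover have "inc S P B \<longleftrightarrow> inc T (f P) (\<Psi> ` B)" if "P \<in> points S" "B \<in> blocks S" for P B
  proof -
    obtain x where "x \<in> X" "P = {y \<in> X. \<Psi> y = \<Psi> x}"
      using \<open>P \<in> points S\<close> unfolding S_points by (rule imageE) blast
    moreover obtain H where "H \<in> blocks T" "B = {y \<in> X. \<Psi> y \<in> H}"
      using \<open>B \<in> blocks S\<close> unfolding S_blocks by (rule imageE) blast
    ultimately show ?thesis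
      by (auto simp: S_inc T_inc f g)
  qed
  ultimately show ?thesis
    unfolding isomorphic_def by blast
qed

section \<open>Finite fields of square order\<close>

text \<open>Multiplication by a non-zero \<open>x\<close> permutes the non-zero elements; comparing
  their product before and after gives \<open>x ^ (card - 1) = 1\<close>.\<close>

lemma finite_field_power_card:
  fixes x :: "'a::{field, finite}"
  shows "x ^ card (UNIV :: 'a set) = x"
proof (cases "x = 0")
  case True
  then show ?thesis by (simp add: card_gt_0_iff)
next
  case False
  have "(\<Prod>y\<in>UNIV - {0}. x * y) = (\<Prod>y\<in>UNIV - {0}. y)"
    by (rule prod.reindex_bij_witness[of _ "\<lambda>y. y / x" "\<lambda>y. x * y"]) (use False in auto)
  then have "x ^ card (UNIV - {0::'a}) = 1"
    by (simp add: prod.distrib)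
  then show ?thesis
    by (metis card_Suc_Diff1 finite iso_tuple_UNIV_I mult.right_neutral power_Suc)
qed

lemma card_eq_sum_card_fibres:
  assumes "finite A"
  shows "card A = (\<Sum>w\<in>f ` A. card {x \<in> A. f x = w})"
proof -
  have "card A = (\<Sum>x\<in>A. 1)"
    by simp
  also have "\<dots> = (\<Sum>w\<in>f ` A. \<Sum>x | x \<in> A \<and> f x = w. 1)"
    using assms by (rule sum.image_gen)
  finally show ?thesis
    by simp
qed

text \<open>The token \<open>F\<close> makes the type of the field with \<open>q ^ 2\<close>
  elements a parameter, to be fixed on interpretation.\<close>

locale square_order_field =
  fixes q :: nat and F :: "'a::{field, finite} itself"
  assumes primepow_q: "primepow q"
    and card_F: "card (UNIV :: 'a set) = q ^ 2"
begin

abbreviation K :: "'a set" where "K \<equiv> GFq q"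

abbreviation Tr :: "'a \<Rightarrow> 'a" where "Tr \<equiv> tr q"

lemma q_gt_1: "q > 1"
  using primepow_gt_Suc_0[OF primepow_q] by simp

text \<open>The characteristic divides the order of the field, a power of the prime below
  \<open>q\<close>, hence equals that prime. This is what makes \<open>x \<mapsto> x ^ q\<close>
  additive.\<close>

lemma q_CHAR: obtains e where "prime CHAR('a)" "q = CHAR('a) ^ e"
proof -
  obtain p k where pk: "prime p" "q = p ^ k"
    using primepow_q by (auto simp: primepow_def)
  have P: "prime CHAR('a)"
    by (rule prime_CHAR_semidom) (simp add: finite_imp_CHAR_pos)
  have "CHAR('a) dvd p ^ (k * 2)"
    using CHAR_dvd_CARD[where ?'a = 'a] by (simp add: card_F pk power_mult)
  then have "CHAR('a) = p"
    using P pk(1) by (meson prime_dvd_power_nat primes_dvd_imp_eq)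
  with pk P that show thesis by blast
qed

section \<open>The Frobenius map, the subfield \<open>K\<close> and the trace\<close>

lemma frob_add: "(x + y :: 'a) ^ q = x ^ q + y ^ q"
  by (rule q_CHAR) (rule freshmans_dream')

lemma frob_sum: "(sum f A :: 'a) ^ q = (\<Sum>i\<in>A. f i ^ q)"
  by (rule q_CHAR) (rule freshmans_dream_sum')

lemma frob_frob: "((x::'a) ^ q) ^ q = x"
  using finite_field_power_card[of x] by (simp add: card_F power2_eq_square flip: power_mult)

text \<open>Additivity applied to \<open>x + (- x) = 0\<close> treats odd and even characteristic
  alike.\<close>

lemma frob_minus: "(- x :: 'a) ^ q = - (x ^ q)"
  using frob_add[of x "- x"] q_gt_1 by (simp add: eq_neg_iff_add_eq_0 add.commute power_0_left)

lemma K_0: "0 \<in> K" and K_1: "1 \<in> K"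
  using q_gt_1 by (auto simp: GFq_def)

lemma K_add: "x \<in> K \<Longrightarrow> y \<in> K \<Longrightarrow> x + y \<in> K"
  by (simp add: GFq_def frob_add)

lemma K_mult: "x \<in> K \<Longrightarrow> y \<in> K \<Longrightarrow> x * y \<in> K"
  by (simp add: GFq_def power_mult_distrib)

lemma K_uminus: "x \<in> K \<Longrightarrow> - x \<in> K"
  by (simp add: GFq_def frob_minus)

lemma K_diff: "x \<in> K \<Longrightarrow> y \<in> K \<Longrightarrow> x - y \<in> K"
  using K_add[of x "- y"] K_uminus[of y] by simp

lemma K_divide: "x \<in> K \<Longrightarrow> y \<in> K \<Longrightarrow> x / y \<in> K"
  by (simp add: GFq_def power_divide)

lemma K_sum: "(\<And>i. i \<in> A \<Longrightarrow> f i \<in> K) \<Longrightarrow> sum f A \<in> K"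
  by (induction A rule: infinite_finite_induct) (auto intro: K_0 K_add)

lemmas K_intros = K_0 K_1 K_add K_mult K_uminus K_diff K_divide K_sum

lemma norm_in_K: "(x::'a) ^ (q + 1) \<in> K"
  by (simp add: GFq_def power_mult_distrib frob_frob mult.commute)

lemma Tr_in_K: "Tr x \<in> K"
  by (simp add: GFq_def tr_def frob_add frob_frob add.commute)

lemma Tr_add: "Tr (x + y) = Tr x + Tr y"
  by (simp add: tr_def frob_add)

lemma Tr_minus: "Tr (- x) = - Tr x"
  by (simp add: tr_def frob_minus)

lemma Tr_diff: "Tr (x - y) = Tr x - Tr y"
  using Tr_add[of x "- y"] by (simp add: Tr_minus)

lemma Tr_sum: "Tr (sum f A) = (\<Sum>i\<in>A. Tr (f i))"
  by (simp add: tr_def frob_sum sum.distrib)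

lemma Tr_mult_K: "u \<in> K \<Longrightarrow> Tr (u * x) = u * Tr x"
  by (simp add: tr_def GFq_def power_mult_distrib algebra_simps)

text \<open>These are the roots of a monic polynomial of degree \<open>q\<close>. The case
  \<open>b = 1\<close>, \<open>c = 0\<close> bounds \<open>K\<close>, and \<open>b = - 1\<close>
  bounds the fibres of the trace.\<close>

lemma card_frob_poly_roots: "card {x::'a. x ^ q = b * x + c} \<le> q"
proof -
  define p where "p = Polynomial.monom 1 q + [:- c, - b:]"
  have "degree [:- c, - b:] < degree (Polynomial.monom (1::'a) q)"
    using q_gt_1 by (auto simp: degree_monom_eq)
  then have deg: "degree p = q"
    unfolding p_def by (subst degree_add_eq_left) (auto simp: degree_monom_eq)
  then have "p \<noteq> 0"
    using q_gt_1 by auto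
  moreover have "{x. x ^ q = b * x + c} = {x. poly p x = 0}"
    by (auto simp: p_def poly_monom algebra_simps eq_neg_iff_add_eq_0 add_eq_0_iff)
  ultimately show ?thesis
    using card_poly_roots_bound deg by metis
qed

text \<open>A squeeze: fibres of size at most \<open>q\<close> force at least \<open>q\<close> trace
  values among \<open>q ^ 2\<close> elements, while all values lie in \<open>K\<close>, which has at
  most \<open>q\<close> elements.\<close>

lemma card_K_and_range_Tr: "card K = q \<and> range Tr = K"
proof -
  have le: "card K \<le> q"
    using card_frob_poly_roots[of 1 0] by (simp add: GFq_def)
  have sub: "range Tr \<subseteq> K"
    using Tr_in_K by auto
  have fib: "card {x. Tr x = w} \<le> q" for w
  proof -
    have "{x. Tr x = w} = {x. x ^ q = - 1 * x + w}"
      by (auto simp: tr_def algebra_simps)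
    then show ?thesis
      using card_frob_poly_roots[of "- 1" w] by metis
  qed
  have "q ^ 2 = (\<Sum>w\<in>range Tr. card {x. Tr x = w})"
    using card_eq_sum_card_fibres[of "UNIV :: 'a set" Tr] by (simp add: card_F)
  also have "\<dots> \<le> card (range Tr) * q"
    using sum_bounded_above[of "range Tr" "\<lambda>w. card {x. Tr x = w}" q] fib by simp
  finally have "q \<le> card (range Tr)"
    using q_gt_1 by (simp add: power2_eq_square)
  moreover have "card (range Tr) \<le> card K"
    using sub by (intro card_mono) auto
  ultimately show ?thesis
    using le sub by (metis card_subset_eq finite le_antisym le_trans)
qed

lemmas card_K = card_K_and_range_Tr[THEN conjunct1]
  and range_Tr = card_K_and_range_Tr[THEN conjunct2]

lemma Tr_surj: assumes "c \<in> K" obtains x where "Tr x = c"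
  using assms range_Tr by (metis imageE)

section \<open>Bases of the field over \<open>K\<close> and trace coordinates\<close>

lemma card_F_gt: "q < card (UNIV :: 'a set)"
  using q_gt_1 by (simp add: card_F power2_eq_square)

lemma not_in_K: obtains \<beta> where "\<beta> \<notin> K"
  using card_F_gt card_K by (metis UNIV_eq_I nat_neq_iff)

text \<open>The trace cannot be injective, and the difference of two elements with equal trace has
  trace zero. Such an \<open>\<epsilon>\<close> later turns \<open>u ^ q - u\<close> into a
  trace.\<close>

lemma trace_zero_element: obtains \<epsilon> :: 'a where "\<epsilon> \<noteq> 0" "\<epsilon> ^ q = - \<epsilon>"
proof -
  have "\<not> inj Tr"
    using card_image[of Tr UNIV] range_Tr card_K card_F_gt by auto
  then obtain x y where "x \<noteq> y" "Tr x = Tr y"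
    by (auto simp: inj_on_def)
  then have "x - y \<noteq> 0" "Tr (x - y) = 0"
    by (auto simp: Tr_diff)
  then show thesis
    using that[of "x - y"] unfolding tr_def eq_neg_iff_add_eq_0 by blast
qed

text \<open>Two expansions with different \<open>\<beta>\<close>-coefficients would write
  \<open>\<beta>\<close> as a quotient of elements of \<open>K\<close>. Injectivity between sets of
  size \<open>q ^ 2\<close> gives surjectivity.\<close>

lemma K_basis:
  assumes "\<beta> \<notin> K"
  shows "bij_betw (\<lambda>(u, v). u + v * \<beta>) (K \<times> K) UNIV"
proof -
  have "inj_on (\<lambda>(u, v). u + v * \<beta>) (K \<times> K)"
  proof (rule inj_onI, clarify)
    fix u v u' v' assume K: "u \<in> K" "v \<in> K" "u' \<in> K" "v' \<in> K" and eq: "u + v * \<beta> = u' + v' * \<beta>"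
    have "v = v'"
    proof (rule ccontr)
      assume "v \<noteq> v'"
      moreover have "\<beta> * (v - v') = u' - u"
        using eq by (simp add: algebra_simps)
      ultimately have "\<beta> = (u' - u) / (v - v')"
        by (simp add: nonzero_eq_divide_eq)
      also have "\<dots> \<in> K"
        using K by (intro K_divide K_diff)
      finally show False
        using assms by simp
    qed
    with eq show "u = u' \<and> v = v'" by simp
  qed
  moreover from this have "(\<lambda>(u, v). u + v * \<beta>) ` (K \<times> K) = UNIV"
    by (intro card_subset_eq) (auto simp: card_image card_cartesian_product card_K card_F power2_eq_square)
  ultimately show ?thesis
    by (simp add: bij_betw_def)
qed

text \<open>The trace form is nondegenerate: if a non-zero \<open>y\<close> had trace zero against
  the basis \<open>1, \<beta>\<close>, then also against \<open>w / y\<close>, contradicting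
  \<open>Tr w = 1\<close>. Bijectivity follows by counting.\<close>

lemma trace_coordinates:
  assumes "\<beta> \<notin> K"
  shows "bij_betw (\<lambda>y. (Tr y, Tr (\<beta> * y))) UNIV (K \<times> K)"
proof -
  have zero: "y = 0" if y: "Tr y = 0" "Tr (\<beta> * y) = 0" for y
  proof (rule ccontr)
    assume "y \<noteq> 0"
    obtain w where w: "Tr w = 1"
      using Tr_surj[OF K_1] .
    obtain u v where "u \<in> K" "v \<in> K" "w / y = u + v * \<beta>"
      using bij_betw_imp_surj_on[OF K_basis[OF assms]] by (force simp: image_iff)
    then have "w = u * y + v * (\<beta> * y)"
      using \<open>y \<noteq> 0\<close> by (simp add: nonzero_divide_eq_eq algebra_simps)
    then have "Tr w = 0"
      using y \<open>u \<in> K\<close> \<open>v \<in> K\<close> by (simp add: Tr_add Tr_mult_K)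
    with w show False by simp
  qed
  have "inj (\<lambda>y. (Tr y, Tr (\<beta> * y)))"
  proof (rule injI)
    fix x y assume "(Tr x, Tr (\<beta> * x)) = (Tr y, Tr (\<beta> * y))"
    then have "Tr (x - y) = 0" "Tr (\<beta> * (x - y)) = 0"
      by (simp_all add: Tr_diff right_diff_distrib)
    then have "x - y = 0"
      by (rule zero)
    then show "x = y" by simp
  qed
  moreover from this have "range (\<lambda>y. (Tr y, Tr (\<beta> * y))) = K \<times> K"
    using Tr_in_K
    by (intro card_subset_eq) (auto simp: card_image card_cartesian_product card_K card_F power2_eq_square)
  ultimately show ?thesis
    by (simp add: bij_betw_def)
qed

section \<open>The point-hyperplane design of an affine space\<close>

lemma AGq_carrier: "x \<in> AGq_points q m \<Longrightarrow> (x :: 'a vec) \<in> carrier_vec m"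
  by (simp add: AGq_points_def)

lemma AGq_index: "(x :: 'a vec) \<in> AGq_points q m \<Longrightarrow> s < m \<Longrightarrow> x $ s \<in> K"
  by (simp add: AGq_points_def)

lemma AGq_pointsI:
  "(x :: 'a vec) \<in> carrier_vec m \<Longrightarrow> (\<And>s. s < m \<Longrightarrow> x $ s \<in> K) \<Longrightarrow> x \<in> AGq_points q m"
  by (simp add: AGq_points_def)

lemma card_AGq_points: "finite (AGq_points q m :: 'a vec set)"
  "card (AGq_points q m :: 'a vec set) = q ^ m"
proof -
  have bij: "bij_betw (vec m) (PiE {..<m} (\<lambda>_. K)) (AGq_points q m)"
  proof (rule bij_betw_byWitness[where f' = "\<lambda>x. restrict (($) x) {..<m}"])
    show "\<forall>f\<in>PiE {..<m} (\<lambda>_. K). restrict (($) (vec m f)) {..<m} = f"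
      by (auto simp: PiE_def extensional_def restrict_def)
    show "\<forall>x\<in>AGq_points q m. vec m (restrict (($) x) {..<m}) = x"
      by (auto simp: AGq_points_def)
    show "vec m ` PiE {..<m} (\<lambda>_. K) \<subseteq> AGq_points q m"
      by (rule image_subsetI, rule AGq_pointsI) auto
    show "(\<lambda>x. restrict (($) x) {..<m}) ` AGq_points q m \<subseteq> PiE {..<m} (\<lambda>_. K)"
      by (rule image_subsetI, rule restrict_PiE_iff[THEN iffD2]) (simp add: AGq_index)
  qed
  show "finite (AGq_points q m :: 'a vec set)"
    using bij_betw_finite[OF bij] by (simp add: finite_PiE)
  show "card (AGq_points q m :: 'a vec set) = q ^ m"
    using bij_betw_same_card[OF bij] by (simp add: card_PiE card_K)
qed

lemma AGq_add: "(x :: 'a vec) \<in> AGq_points q m \<Longrightarrow> y \<in> AGq_points q m \<Longrightarrow> x + y \<in> AGq_points q m"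
  by (rule AGq_pointsI) (auto simp: AGq_points_def intro!: K_add)

lemma AGq_diff: "(x :: 'a vec) \<in> AGq_points q m \<Longrightarrow> y \<in> AGq_points q m \<Longrightarrow> x - y \<in> AGq_points q m"
  by (rule AGq_pointsI) (auto simp: AGq_points_def intro!: K_diff)

lemma AGq_smult: "(x :: 'a vec) \<in> AGq_points q m \<Longrightarrow> c \<in> K \<Longrightarrow> c \<cdot>\<^sub>v x \<in> AGq_points q m"
  by (rule AGq_pointsI) (auto simp: AGq_points_def intro!: K_mult)

lemma AGq_scalar_prod: "(x :: 'a vec) \<in> AGq_points q m \<Longrightarrow> y \<in> AGq_points q m \<Longrightarrow> x \<bullet> y \<in> K"
  by (auto simp: AGq_points_def scalar_prod_def intro!: K_sum K_mult)

lemma AGq_smult_scalar_prod: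
  "(x :: 'a vec) \<in> AGq_points q m \<Longrightarrow> y \<in> AGq_points q m \<Longrightarrow> (r \<cdot>\<^sub>v x) \<bullet> y = r * (x \<bullet> y)"
  by (intro smult_scalar_prod_distrib[of _ m] AGq_carrier)

lemma AGq_scalar_prod_add:
  "(x :: 'a vec) \<in> AGq_points q m \<Longrightarrow> y \<in> AGq_points q m \<Longrightarrow> z \<in> AGq_points q m \<Longrightarrow>
    x \<bullet> (y + z) = x \<bullet> y + x \<bullet> z"
  by (intro scalar_prod_add_distrib[of _ m] AGq_carrier)

lemma AGq_unit_vec: "unit_vec m i \<in> (AGq_points q m :: 'a vec set)"
  by (rule AGq_pointsI) (auto simp: unit_vec_def K_0 K_1)

text \<open>Translation by \<open>b - a\<close> carries the fibre over \<open>f a\<close>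
  injectively into the fibre over \<open>f b\<close>, so all fibres over the image have equal size.
  The general codomain covers one linear form as well as a pair of them.\<close>

lemma card_fibre_additive:
  fixes f :: "'a vec \<Rightarrow> 'b::ab_group_add"
  assumes add: "\<And>x y. x \<in> AGq_points q m \<Longrightarrow> y \<in> AGq_points q m \<Longrightarrow> f (x + y) = f x + f y"
    and w: "w \<in> f ` AGq_points q m"
  shows "card {x \<in> AGq_points q m. f x = w} * card (f ` AGq_points q m) = q ^ m"
proof -
  have le: "card {x \<in> AGq_points q m. f x = f a} \<le> card {x \<in> AGq_points q m. f x = f b}"
    if ab: "a \<in> AGq_points q m" "b \<in> AGq_points q m" for a b
  proof (rule card_inj_on_le)
    show "inj_on (\<lambda>x. x + (b - a)) {x \<in> AGq_points q m. f x = f a}"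
    proof (rule inj_onI)
      fix x y assume x: "x \<in> {x \<in> AGq_points q m. f x = f a}"
        and y: "y \<in> {x \<in> AGq_points q m. f x = f a}" and eq: "x + (b - a) = y + (b - a)"
      have "x $ i = y $ i" if "i < m" for i
        using arg_cong[OF eq, of "\<lambda>v. v $ i"] that x y ab
        by (auto simp: AGq_points_def)
      then show "x = y"
        using x y by (intro eq_vecI) (auto simp: AGq_points_def)
    qed
    have "f (b - a) + f a = f b"
    proof -
      have "(b - a) + a = b"
        using ab by (intro eq_vecI) (auto simp: AGq_points_def)
      then show ?thesis
        using add[of "b - a" a] ab AGq_diff by simp
    qed
    then have "f (b - a) = f b - f a"
      by (simp add: algebra_simps)
    then show "(\<lambda>x. x + (b - a)) ` {x \<in> AGq_points q m. f x = f a} \<subseteq> {x \<in> AGq_points q m. f x = f b}"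
      using ab by (auto simp: add AGq_add AGq_diff)
  qed (simp add: card_AGq_points)
  have "q ^ m = (\<Sum>v\<in>f ` AGq_points q m. card {x \<in> AGq_points q m. f x = v})"
    using card_eq_sum_card_fibres[OF card_AGq_points(1), where f = f] by (simp add: card_AGq_points)
  also have "\<dots> = (\<Sum>v\<in>f ` AGq_points q m. card {x \<in> AGq_points q m. f x = w})"
    using w le by (intro sum.cong refl le_antisym) auto
  finally show ?thesis
    by simp
qed

lemma scalar_prod_image_K:
  assumes a: "(a :: 'a vec) \<in> AGq_points q m" "a \<noteq> 0\<^sub>v m"
  shows "(\<lambda>x. a \<bullet> x) ` AGq_points q m = K"
proof
  show "(\<lambda>x. a \<bullet> x) ` AGq_points q m \<subseteq> K"
    using a by (auto intro: AGq_scalar_prod)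
  obtain i where i: "i < m" "a $ i \<noteq> 0"
    using a by (metis AGq_carrier carrier_vecD eq_vecI index_zero_vec)
  show "K \<subseteq> (\<lambda>x. a \<bullet> x) ` AGq_points q m"
  proof
    fix c assume "c \<in> K"
    then have "(c / a $ i) \<cdot>\<^sub>v unit_vec m i \<in> AGq_points q m"
      using i a by (intro AGq_smult AGq_unit_vec K_divide AGq_index)
    moreover have "a \<bullet> ((c / a $ i) \<cdot>\<^sub>v unit_vec m i) = c"
      using i AGq_carrier[OF a(1)] by simp
    ultimately show "c \<in> (\<lambda>x. a \<bullet> x) ` AGq_points q m"
      by (metis imageI)
  qed
qed

text \<open>Independence provides a non-zero 2 by 2 minor of the rows \<open>a\<close>,
  \<open>b\<close>, and two coordinates then suffice to prescribe both products.\<close>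

lemma scalar_prod_pair_image_K:
  assumes a: "(a :: 'a vec) \<in> AGq_points q m" "a \<noteq> 0\<^sub>v m" and b: "b \<in> AGq_points q m"
    and indep: "\<And>r. r \<in> K \<Longrightarrow> b \<noteq> r \<cdot>\<^sub>v a"
  shows "(\<lambda>x. (a \<bullet> x, b \<bullet> x)) ` AGq_points q m = K \<times> K"
proof
  show "(\<lambda>x. (a \<bullet> x, b \<bullet> x)) ` AGq_points q m \<subseteq> K \<times> K"
    using a b by (auto intro: AGq_scalar_prod)
  obtain i where i: "i < m" "a $ i \<noteq> 0"
    using a by (metis AGq_carrier carrier_vecD eq_vecI index_zero_vec)
  \<comment> \<open>This ratio makes \<open>b\<close> and the multiple of \<open>a\<close> agree at
    \<open>i\<close>, so they must differ at some \<open>j\<close>, which makes the minor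
    \<open>\<delta>\<close> non-zero.\<close>
  have "b $ i / a $ i \<in> K"
    using i a b by (intro K_intros AGq_index)
  then have "b \<noteq> (b $ i / a $ i) \<cdot>\<^sub>v a"
    by (rule indep)
  then obtain j where j: "j < m" "b $ j \<noteq> b $ i / a $ i * a $ j"
    using AGq_carrier[OF a(1)] AGq_carrier[OF b]
    by (metis carrier_vecD eq_vecI index_smult_vec)
  define \<delta> where "\<delta> = a $ i * b $ j - a $ j * b $ i"
  have \<delta>: "\<delta> \<noteq> 0"
    using i j by (auto simp: \<delta>_def field_simps)
  have aK: "a $ i \<in> K" "a $ j \<in> K" "b $ i \<in> K" "b $ j \<in> K"
    using a b i j by (auto intro: AGq_index)
  then have \<delta>K: "\<delta> \<in> K"
    unfolding \<delta>_def by (intro K_intros)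
  show "K \<times> K \<subseteq> (\<lambda>x. (a \<bullet> x, b \<bullet> x)) ` AGq_points q m"
  proof clarify
    fix c d assume cd: "c \<in> K" "d \<in> K"
    \<comment> \<open>Cramer's rule for \<open>s * a $ i + t * a $ j = c\<close> and
      \<open>s * b $ i + t * b $ j = d\<close>.\<close>
    define s t where "s = (c * b $ j - d * a $ j) / \<delta>" and "t = (a $ i * d - b $ i * c) / \<delta>"
    define x where "x = s \<cdot>\<^sub>v unit_vec m i + t \<cdot>\<^sub>v unit_vec m j"
    have "s \<in> K" "t \<in> K"
      unfolding s_def t_def using cd aK \<delta>K by (auto intro!: K_intros)
    then have x: "x \<in> AGq_points q m"
      unfolding x_def by (intro AGq_add AGq_smult AGq_unit_vec)
    have dot: "v \<bullet> x = s * v $ i + t * v $ j" if "v \<in> carrier_vec m" for v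
      unfolding x_def using that i j by (subst scalar_prod_add_distrib[of _ m]) auto
    have "(c * b $ j - d * a $ j) * a $ i + (a $ i * d - b $ i * c) * a $ j = c * \<delta>"
      "(c * b $ j - d * a $ j) * b $ i + (a $ i * d - b $ i * c) * b $ j = d * \<delta>"
      by (simp_all add: \<delta>_def algebra_simps)
    then have "a \<bullet> x = c" "b \<bullet> x = d"
      using \<delta> dot[OF AGq_carrier[OF a(1)]] dot[OF AGq_carrier[OF b]]
      by (simp_all add: s_def t_def add_divide_distrib[symmetric])
    then show "(c, d) \<in> (\<lambda>x. (a \<bullet> x, b \<bullet> x)) ` AGq_points q m"
      using x by force
  qed
qed

section \<open>Hyperplanes: parallelism and counting\<close>

definition hyp :: "nat \<Rightarrow> 'a vec \<Rightarrow> 'a \<Rightarrow> 'a vec set" where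
  "hyp m a c = {x \<in> AGq_points q m. a \<bullet> x = c}"

lemma hyp_smult:
  assumes "a \<in> AGq_points q m" "r \<noteq> 0"
  shows "hyp m (r \<cdot>\<^sub>v a) (r * c) = hyp m a c"
  using assms by (auto simp: hyp_def AGq_smult_scalar_prod)

lemma smult_nonzeroD:
  "r \<cdot>\<^sub>v a \<noteq> 0\<^sub>v m \<Longrightarrow> (a :: 'a vec) \<in> carrier_vec m \<Longrightarrow> r \<noteq> 0"
  by (metis carrier_vecD eq_vecI index_smult_vec index_zero_vec mult_zero_left)

text \<open>Were the normals independent, the pair \<open>(c, d)\<close> would be attained at a
  common point.\<close>

lemma disjoint_hyp_parallel:
  assumes a: "a \<in> AGq_points q m" "a \<noteq> 0\<^sub>v m" and b: "b \<in> AGq_points q m" "b \<noteq> 0\<^sub>v m"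
    and K: "c \<in> K" "d \<in> K" and disj: "hyp m a c \<inter> hyp m b d = {}"
  obtains r where "r \<in> K" "r \<noteq> 0" "b = r \<cdot>\<^sub>v a"
proof -
  have "\<exists>r\<in>K. b = r \<cdot>\<^sub>v a"
  proof (rule ccontr)
    assume "\<not> ?thesis"
    then have "(c, d) \<in> (\<lambda>x. (a \<bullet> x, b \<bullet> x)) ` AGq_points q m"
      using scalar_prod_pair_image_K[OF a b(1)] K by blast
    with disj show False
      by (auto simp: hyp_def)
  qed
  then obtain r where r: "r \<in> K" "b = r \<cdot>\<^sub>v a"
    by blast
  moreover have "r \<noteq> 0"
    using smult_nonzeroD r b AGq_carrier[OF a(1)] by metis
  ultimately show thesis
    using that by blast
qed

text \<open>Raising the constant of one description by 1 gives a hyperplane disjoint from the other,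
  which reduces equality to the disjoint case.\<close>

lemma hyp_eqE:
  assumes a: "a \<in> AGq_points q m" "a \<noteq> 0\<^sub>v m" and b: "b \<in> AGq_points q m" "b \<noteq> 0\<^sub>v m"
    and K: "c \<in> K" "d \<in> K" and eq: "hyp m a c = hyp m b d"
  obtains r where "r \<in> K" "r \<noteq> 0" "b = r \<cdot>\<^sub>v a"
proof -
  have "hyp m a c \<inter> hyp m b (d + 1) = {}"
    unfolding eq by (auto simp: hyp_def)
  then show thesis
    using disjoint_hyp_parallel[OF a b K(1) K_add[OF K(2) K_1]] that by blast
qed

lemma card_hyp:
  assumes "a \<in> AGq_points q m" "a \<noteq> 0\<^sub>v m" "c \<in> K"
  shows "card (hyp m a c) = q ^ (m - 1)"
proof -
  \<comment> \<open>A non-zero normal excludes dimension 0, where \<open>m - 1\<close> would be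
    truncated.\<close>
  have "m \<noteq> 0"
    using assms by (metis AGq_carrier carrier_vecD eq_vecI less_nat_zero_code index_zero_vec(2))
  moreover have "card (hyp m a c) * card ((\<lambda>x. a \<bullet> x) ` AGq_points q m) = q ^ m"
    unfolding hyp_def using assms
    by (intro card_fibre_additive) (auto simp: scalar_prod_image_K AGq_scalar_prod_add)
  then have "card (hyp m a c) * q = q ^ m"
    using assms by (simp add: scalar_prod_image_K card_K)
  ultimately show ?thesis
    using q_gt_1 by (cases m) auto
qed

text \<open>With proportional normals the hyperplanes are distinct parallels. Otherwise the
  intersection is a fibre of an additive map onto \<open>K \<times> K\<close>, of size
  \<open>q ^ m / q ^ 2\<close>.\<close>

lemma card_hyp_Int:
  assumes m: "m \<ge> 2"
    and a: "a \<in> AGq_points q m" "a \<noteq> 0\<^sub>v m" and b: "b \<in> AGq_points q m" "b \<noteq> 0\<^sub>v m"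
    and K: "c \<in> K" "d \<in> K" and ne: "hyp m a c \<noteq> hyp m b d"
  shows "hyp m a c \<inter> hyp m b d = {} \<or> card (hyp m a c \<inter> hyp m b d) = q ^ (m - 2)"
proof (cases "\<exists>r\<in>K. b = r \<cdot>\<^sub>v a")
  case True
  then obtain r where r: "r \<in> K" "b = r \<cdot>\<^sub>v a"
    by blast
  moreover have "r \<noteq> 0"
    using smult_nonzeroD r b AGq_carrier[OF a(1)] by metis
  ultimately have eq: "hyp m b d = hyp m a (d / r)"
    using hyp_smult[OF a(1), of r "d / r"] by simp
  then have "c \<noteq> d / r"
    using ne by blast
  then have "hyp m a c \<inter> hyp m a (d / r) = {}"
    by (auto simp: hyp_def)
  then show ?thesis
    unfolding eq by blast
next
  case False
  have im: "(\<lambda>x. (a \<bullet> x, b \<bullet> x)) ` AGq_points q m = K \<times> K"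
    using False by (intro scalar_prod_pair_image_K[OF a b(1)]) auto
  have "card {x \<in> AGq_points q m. (a \<bullet> x, b \<bullet> x) = (c, d)}
      * card ((\<lambda>x. (a \<bullet> x, b \<bullet> x)) ` AGq_points q m) = q ^ m"
    using K a b by (intro card_fibre_additive) (auto simp: im AGq_scalar_prod_add)
  moreover have "{x \<in> AGq_points q m. (a \<bullet> x, b \<bullet> x) = (c, d)} = hyp m a c \<inter> hyp m b d"
    by (auto simp: hyp_def)
  ultimately have "card (hyp m a c \<inter> hyp m b d) * q ^ 2 = q ^ m"
    by (simp add: im card_cartesian_product card_K power2_eq_square)
  also have "\<dots> = q ^ (m - 2) * q ^ 2"
    using m by (metis le_add_diff_inverse2 power_add)
  finally show ?thesis
    using q_gt_1 by simp
qed

text \<open>Such a hyperplane has a non-zero normal orthogonal to \<open>p - p'\<close>, and its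
  constant is forced by \<open>p\<close>. There are \<open>q ^ (m - 1) - 1\<close> such normals, and
  each hyperplane arises from \<open>q - 1\<close> of them.\<close>

lemma card_hyp_through_two_points:
  fixes p p' :: "'a vec"
  assumes m: "m \<ge> 2" and p: "p \<in> AGq_points q m" "p' \<in> AGq_points q m" "p \<noteq> p'"
  shows "card {H \<in> AGq_hyperplanes q m. p \<in> H \<and> p' \<in> H} = (\<Sum>s\<le>m - 2. q ^ s)"
proof -
  define A where "A = {a \<in> AGq_points q m. a \<bullet> (p - p') = 0} - {0\<^sub>v m}"
  define h where "h a = hyp m a (a \<bullet> p)" for a
  have p': "a \<bullet> (p - p') = a \<bullet> p - a \<bullet> p'" if "a \<in> AGq_points q m" for a
    using p that by (intro scalar_prod_minus_distrib[of _ m] AGq_carrier)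
  have im: "{H \<in> AGq_hyperplanes q m. p \<in> H \<and> p' \<in> H} = h ` A"
  proof (intro equalityI subsetI)
    fix H assume "H \<in> {H \<in> AGq_hyperplanes q m. p \<in> H \<and> p' \<in> H}"
    then obtain a where "a \<in> AGq_points q m" "a \<noteq> 0\<^sub>v m" "H = hyp m a (a \<bullet> p)" "a \<bullet> p = a \<bullet> p'"
      by (auto simp: AGq_hyperplanes_def hyp_def)
    then have "a \<in> A" "H = h a"
      by (simp_all add: A_def h_def p')
    then show "H \<in> h ` A"
      by blast
  next
    fix H assume "H \<in> h ` A"
    then obtain a where "a \<in> A" "H = h a"
      by blast
    then show "H \<in> {H \<in> AGq_hyperplanes q m. p \<in> H \<and> p' \<in> H}"
    proof -
      have a: "a \<in> AGq_points q m" "a \<noteq> 0\<^sub>v m" "a \<bullet> (p - p') = 0"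
        using \<open>a \<in> A\<close> by (simp_all add: A_def)
      have "hyp m a (a \<bullet> p) \<in> AGq_hyperplanes q m"
        unfolding AGq_hyperplanes_def hyp_def using a AGq_scalar_prod[OF a(1) p(1)] by blast
      then show ?thesis
        using \<open>H = h a\<close> p p'[OF a(1)] a(3) by (simp add: h_def hyp_def)
    qed
  qed
  have diff: "p - p' \<in> AGq_points q m" "p - p' \<noteq> 0\<^sub>v m"
  proof -
    show "p - p' \<in> AGq_points q m"
      using p by (intro AGq_diff)
    show "p - p' \<noteq> 0\<^sub>v m"
    proof
      assume eq: "p - p' = 0\<^sub>v m"
      have "p $ i = p' $ i" if "i < m" for i
        using arg_cong[OF eq, of "\<lambda>v. v $ i"] that p by (auto simp: AGq_points_def)
      then show False
        using p AGq_carrier by (metis carrier_vecD eq_vecI)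
    qed
  qed
  \<comment> \<open>By symmetry of the product the normals themselves fill a hyperplane with normal
    \<open>p - p'\<close>, so \<open>card_hyp\<close> counts them; the zero vector is then
    removed.\<close>
  have "{a \<in> AGq_points q m. a \<bullet> (p - p') = 0} = hyp m (p - p') 0"
    using comm_scalar_prod[OF AGq_carrier AGq_carrier[OF diff(1)]] by (auto simp: hyp_def)
  moreover have "0\<^sub>v m \<in> hyp m (p - p') 0"
    using AGq_carrier[OF diff(1)] by (simp add: hyp_def AGq_points_def K_0)
  ultimately have card_A: "card A = q ^ (m - 1) - 1"
    using card_hyp[OF diff K_0] by (simp add: A_def card_Diff_singleton)
  \<comment> \<open>Normals with the same hyperplane as \<open>a\<close> are exactly its non-zero
    \<open>K\<close>-multiples.\<close>
  have fibre: "card {b \<in> A. h b = h a} = q - 1" if a: "a \<in> A" for a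
  proof -
    have aV: "a \<in> AGq_points q m" "a \<noteq> 0\<^sub>v m" "a \<bullet> (p - p') = 0"
      using a by (auto simp: A_def)
    obtain i where i: "i < m" "a $ i \<noteq> 0"
      using aV by (metis AGq_carrier carrier_vecD eq_vecI index_zero_vec)
    have "{b \<in> A. h b = h a} = (\<lambda>r. r \<cdot>\<^sub>v a) ` (K - {0})"
    proof (intro equalityI subsetI)
      fix b assume b: "b \<in> {b \<in> A. h b = h a}"
      then have "b \<in> AGq_points q m" "b \<noteq> 0\<^sub>v m" "hyp m a (a \<bullet> p) = hyp m b (b \<bullet> p)"
        by (simp_all add: A_def h_def)
      then obtain r where "r \<in> K" "r \<noteq> 0" "b = r \<cdot>\<^sub>v a"
        using hyp_eqE[OF aV(1,2)] p aV(1) AGq_scalar_prod by metis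
      then show "b \<in> (\<lambda>r. r \<cdot>\<^sub>v a) ` (K - {0})"
        by blast
    next
      fix b assume "b \<in> (\<lambda>r. r \<cdot>\<^sub>v a) ` (K - {0})"
      then obtain r where r: "r \<in> K" "r \<noteq> 0" "b = r \<cdot>\<^sub>v a"
        by blast
      have "b $ i \<noteq> 0"
        using r i AGq_carrier[OF aV(1)] by simp
      then have "b \<noteq> 0\<^sub>v m"
        using i by auto
      then have "b \<in> A"
        using r aV diff(1) by (auto simp: A_def AGq_smult AGq_smult_scalar_prod)
      moreover have "h b = h a"
        using hyp_smult[OF aV(1) r(2)] r p aV(1) by (simp add: h_def AGq_smult_scalar_prod)
      ultimately show "b \<in> {b \<in> A. h b = h a}"
        by simp
    qed
    moreover have "inj_on (\<lambda>r. r \<cdot>\<^sub>v a) (K - {0})"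
    proof (rule inj_onI)
      fix r s assume "r \<cdot>\<^sub>v a = s \<cdot>\<^sub>v a"
      then have "(r \<cdot>\<^sub>v a) $ i = (s \<cdot>\<^sub>v a) $ i"
        by simp
      then show "r = s"
        using i AGq_carrier[OF aV(1)] by simp
    qed
    ultimately show ?thesis
      by (simp add: card_image card_Diff_singleton K_0 card_K)
  qed
  have "finite A"
    by (simp add: A_def card_AGq_points)
  then have "card A = (\<Sum>w\<in>h ` A. card {b \<in> A. h b = w})"
    by (rule card_eq_sum_card_fibres)
  also have "\<dots> = (\<Sum>w\<in>h ` A. q - 1)"
    by (intro sum.cong) (auto simp: fibre)
  finally have "card (h ` A) * (q - 1) = q ^ (m - 1) - 1"
    by (simp add: card_A)
  \<comment> \<open>The geometric sum in multiplied form, so that no division of natural numbers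
    occurs.\<close>
  moreover have "(\<Sum>s\<le>k. q ^ s) * (q - 1) = q ^ Suc k - 1" for k
  proof (induction k)
    case (Suc k)
    have "1 \<le> q ^ Suc k"
      using q_gt_1 by simp
    then show ?case
      using Suc q_gt_1 by (auto simp: algebra_simps diff_mult_distrib2)
  qed simp
  moreover have "Suc (m - 2) = m - 1"
    using m by simp
  ultimately have "(\<Sum>s\<le>m - 2. q ^ s) * (q - 1) = card (h ` A) * (q - 1)"
    by metis
  then show ?thesis
    unfolding im using q_gt_1 by simp
qed

lemma affine_two_design_AGq:
  assumes m: "m \<ge> 2"
  shows "affine_two_design (AGq_design q m :: ('a vec, 'a vec set) inc_struct)
    (q ^ m) (q ^ (m - 1)) (\<Sum>s\<le>m - 2. q ^ s) (q ^ (m - 2))"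
proof -
  have B: "\<exists>a c. H = hyp m a c \<and> a \<in> AGq_points q m \<and> a \<noteq> 0\<^sub>v m \<and> c \<in> K"
    if "H \<in> AGq_hyperplanes q m" for H
    using that by (auto simp: AGq_hyperplanes_def hyp_def)
  have des: "points (AGq_design q m :: ('a vec, 'a vec set) inc_struct) = AGq_points q m"
    "blocks (AGq_design q m :: ('a vec, 'a vec set) inc_struct) = AGq_hyperplanes q m"
    "inc (AGq_design q m :: ('a vec, 'a vec set) inc_struct) = (\<in>)"
    by (simp_all add: AGq_design_def)
  have bp: "block_points (AGq_design q m) H = H" if "H \<in> AGq_hyperplanes q m" for H :: "'a vec set"
    using that by (auto simp: block_points_def AGq_design_def AGq_hyperplanes_def)
  have "finite (AGq_hyperplanes q m :: 'a vec set set)"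
    by (rule finite_subset[of _ "Pow (AGq_points q m)"])
      (auto simp: AGq_hyperplanes_def card_AGq_points)
  moreover have "\<exists>!H'. H' \<in> AGq_hyperplanes q m \<and> p \<in> H' \<and> H \<inter> H' = {}"
    if p: "p \<in> AGq_points q m" and H: "H \<in> AGq_hyperplanes q m" and pH: "p \<notin> H"
    for p and H :: "'a vec set"
  proof -
    obtain a c where ac: "H = hyp m a c" "a \<in> AGq_points q m" "a \<noteq> 0\<^sub>v m" "c \<in> K"
      using B[OF H] by blast
    show ?thesis
    \<comment> \<open>The parallel through \<open>p\<close> keeps the normal \<open>a\<close>. Any
      other disjoint hyperplane has a proportional normal, and passing through \<open>p\<close>
      fixes its constant.\<close>
    proof (intro ex1I[of _ "hyp m a (a \<bullet> p)"])
      show "hyp m a (a \<bullet> p) \<in> AGq_hyperplanes q m \<and> p \<in> hyp m a (a \<bullet> p) \<and> H \<inter> hyp m a (a \<bullet> p) = {}"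
        using ac p pH AGq_scalar_prod[OF ac(2) p] by (auto simp: AGq_hyperplanes_def hyp_def)
    next
      fix H' assume H': "H' \<in> AGq_hyperplanes q m \<and> p \<in> H' \<and> H \<inter> H' = {}"
      then obtain b d where bd: "H' = hyp m b d" "b \<in> AGq_points q m" "b \<noteq> 0\<^sub>v m" "d \<in> K"
        using B by blast
      obtain r where r: "r \<in> K" "r \<noteq> 0" "b = r \<cdot>\<^sub>v a"
        using disjoint_hyp_parallel[OF ac(2,3) bd(2,3) ac(4) bd(4)] H' ac bd by metis
      have "d = r * (a \<bullet> p)"
        using H' bd(1) r(3) ac(2) p by (auto simp: hyp_def AGq_smult_scalar_prod)
      then show "H' = hyp m a (a \<bullet> p)"
        using hyp_smult[OF ac(2) r(2)] bd r by simp
    qed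
  qed
  moreover have "H \<inter> H' = {} \<or> card (H \<inter> H') = q ^ (m - 2)"
    if "H \<in> AGq_hyperplanes q m" "H' \<in> AGq_hyperplanes q m" "H \<noteq> H'" for H H' :: "'a vec set"
    using that card_hyp_Int[OF m] B by metis
  moreover have "card H = q ^ (m - 1)" if "H \<in> AGq_hyperplanes q m" for H :: "'a vec set"
    using B[OF that] card_hyp by blast
  ultimately show ?thesis
    unfolding affine_two_design_def two_design_def
    using card_hyp_through_two_points[OF m]
    by (simp add: des card_AGq_points bp cong: conj_cong)
qed

end

section \<open>The affine action of the group\<close>

text \<open>The coefficients imitate column \<open>k\<close> of \<open>Dmat\<close> in its first
  \<open>m\<close> rows: a one on the diagonal and, in the column singled out by \<open>P\<close>,
  the entries of \<open>j\<close>.\<close>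

lemma sum_lessThan_delta_add:
  fixes f g :: "nat \<Rightarrow> 'a::semiring_1"
  shows "(\<Sum>s<m. (if s = k then 1 else if P then f s else 0) * g s)
    = (if P then (\<Sum>s<m. if s = k then 0 else f s * g s) else 0) + (if k < m then g k else 0)"
proof -
  have "(\<Sum>s<m. (if s = k then 1 else if P then f s else 0) * g s)
      = (\<Sum>s<m. (if P then (if s = k then 0 else f s * g s) else 0) + (if s = k then g s else 0))"
    by (intro sum.cong) auto
  then show ?thesis
    by (simp add: sum.distrib)
qed

text \<open>Fits the coordinates used later: two for each \<open>s < m\<close> and one last
  coordinate for the quadratic form.\<close>

lemma sum_lessThan_double:
  fixes f :: "nat \<Rightarrow> 'a::comm_monoid_add"
  shows "(\<Sum>k<2 * m + 1. f k) = (\<Sum>s<m. f (2 * s) + f (2 * s + 1)) + f (2 * m)"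
  by (induction m) (simp_all add: add.assoc)

lemma less_double_Suc_cases:
  assumes "k < 2 * m + (1::nat)"
  obtains s where "s < m" "k = 2 * s" | s where "s < m" "k = 2 * s + 1" | "k = 2 * m"
proof (cases "k = 2 * m")
  case False
  then have "k div 2 < m" "k = 2 * (k div 2) \<or> k = 2 * (k div 2) + 1"
    using assms by linarith+
  then show thesis
    using that by blast
qed (use that in blast)

text \<open>In affine coordinates \<open>X \<mapsto> X D\<close> is \<open>affine_action\<close>; it is the inverse of the
  collineation given by \<open>D\<^sup>-\<^sup>1\<close>, so images of sets of points under \<open>G\<close> are its preimages.\<close>

definition affine_action :: "nat \<Rightarrow> 'a::field vec \<Rightarrow> 'a vec \<Rightarrow> 'a vec \<Rightarrow> 'a vec" where
  "affine_action m i j y = vec (Suc m)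
     (\<lambda>k. if k = m then y $ m + (\<Sum>s<m. j $ s * y $ s) + i $ m else y $ k + i $ k)"

lemma affine_action_carrier: "affine_action m i j y \<in> carrier_vec (Suc m)"
  by (simp add: affine_action_def)

lemma Dmat_carrier: "Dmat (Suc m) i j \<in> carrier_mat (Suc m + 1) (Suc m + 1)"
  by (simp add: Dmat_def)

lemma Dmat_transpose_mult_vec:
  assumes X: "X \<in> carrier_vec (Suc m + 1)"
  shows "transpose_mat (Dmat (Suc m) i j) *\<^sub>v X = vec (Suc m + 1)
    (\<lambda>k. if k = Suc m then X $ Suc m
      else if k = m then X $ m + (\<Sum>s<m. j $ s * X $ s) + i $ m * X $ Suc m
      else X $ k + i $ k * X $ Suc m)" (is "_ = ?rhs")
proof (rule eq_vecI)
  fix k assume "k < dim_vec ?rhs"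
  then have k: "k < Suc (Suc m)" by simp
  have "(transpose_mat (Dmat (Suc m) i j) *\<^sub>v X) $ k
      = (\<Sum>r<Suc (Suc m). Dmat (Suc m) i j $$ (r, k) * X $ r)"
    using X k Dmat_carrier[of m i j]
    by (simp add: scalar_prod_def atLeast0LessThan del: sum.lessThan_Suc)
  \<comment> \<open>Rows \<open>m\<close> and \<open>Suc m\<close> are split off; in the rows above,
    only the diagonal and column \<open>m\<close> can be non-zero.\<close>
  also have "\<dots> = (\<Sum>r<m. (if r = k then 1 else if k = m then j $ r else 0) * X $ r)
      + Dmat (Suc m) i j $$ (m, k) * X $ m + Dmat (Suc m) i j $$ (Suc m, k) * X $ Suc m"
  proof -
    have "(\<Sum>r<m. Dmat (Suc m) i j $$ (r, k) * X $ r)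
        = (\<Sum>r<m. (if r = k then 1 else if k = m then j $ r else 0) * X $ r)"
      using k by (intro sum.cong refl) (auto simp: Dmat_def)
    then show ?thesis by simp
  qed
  also have "\<dots> = ?rhs $ k"
  proof -
    consider "k < m" | "k = m" | "k = Suc m"
      using k by linarith
    then show ?thesis
    proof cases
      case 2
      then have "(\<Sum>s<m. if s = k then 0 else j $ s * X $ s) = (\<Sum>s<m. j $ s * X $ s)"
        by (intro sum.cong) auto
      with 2 show ?thesis
        by (subst sum_lessThan_delta_add) (simp add: Dmat_def)
    qed (subst sum_lessThan_delta_add; simp add: Dmat_def)+
  qed
  finally show "(transpose_mat (Dmat (Suc m) i j) *\<^sub>v X) $ k = ?rhs $ k" .
qed (simp add: Dmat_def)

lemma Dmat_transpose_mult_homog: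
  assumes "y \<in> carrier_vec (Suc m)"
  shows "transpose_mat (Dmat (Suc m) i j) *\<^sub>v (y @\<^sub>v vec 1 (\<lambda>_. 1)) =
    affine_action m i j y @\<^sub>v vec 1 (\<lambda>_. 1)"
proof -
  have "y @\<^sub>v vec 1 (\<lambda>_. 1) \<in> carrier_vec (Suc m + 1)"
    using assms by (intro carrier_vecI) simp
  then show ?thesis
    using assms unfolding Dmat_transpose_mult_vec[OF \<open>y @\<^sub>v _ \<in> _\<close>]
    by (intro eq_vecI) (auto simp: affine_action_def intro!: sum.cong)
qed

text \<open>The transpose has trivial kernel by substitution: coordinate \<open>Suc m\<close>
  vanishes first, then those below \<open>m\<close>, finally coordinate \<open>m\<close>. Hence the
  determinant is non-zero.\<close>

lemma is_inverse_mat_Dmat: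
  obtains A where "is_inverse_mat (Suc m + 1) (Dmat (Suc m) i j) A"
proof -
  let ?D = "Dmat (Suc m) i j"
  have inj: "X = 0\<^sub>v (Suc m + 1)"
    if X: "X \<in> carrier_vec (Suc m + 1)" and eq: "transpose_mat ?D *\<^sub>v X = 0\<^sub>v (Suc m + 1)" for X
  proof -
    have e: "(transpose_mat ?D *\<^sub>v X) $ k = 0" if "k < Suc (Suc m)" for k
      unfolding eq using that by simp
    note e = e[unfolded Dmat_transpose_mult_vec[OF X]]
    have last: "X $ Suc m = 0"
      using e[of "Suc m"] by simp
    have small: "X $ k = 0" if "k < m" for k
      using e[of k] that last by simp
    have "X $ m = 0"
      using e[of m] last small by simp
    with last small have "X $ k = 0" if "k < Suc (Suc m)" for k
      using that by (metis less_antisym)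
    then show ?thesis
      using X by (intro eq_vecI) auto
  qed
  have "det (transpose_mat ?D) \<noteq> 0"
    using inj det_0_iff_vec_prod_zero_field[of "transpose_mat ?D" "Suc m + 1"]
      Dmat_carrier[of m i j] by auto
  then have "det ?D \<noteq> 0"
    using det_transpose[OF Dmat_carrier[of m i j]] by simp
  then obtain A where "A \<in> carrier_mat (Suc m + 1) (Suc m + 1)" "?D * A = 1\<^sub>m (Suc m + 1)"
    "A * ?D = 1\<^sub>m (Suc m + 1)"
    using det_non_zero_imp_unit[OF Dmat_carrier[of m i j], of "\<lambda>_. 0"]
    by (auto simp: Units_def ring_mat_def)
  then have "is_inverse_mat (Suc m + 1) ?D A"
    using Dmat_carrier[of m i j] by (simp add: is_inverse_mat_def inverts_mat_def)
  then show thesis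
    by (rule that)
qed

section \<open>Collineations in affine coordinates\<close>

lemma proj_point_eq_iff:
  assumes "X \<in> carrier_vec m" "Y \<in> carrier_vec m"
  shows "proj_point X = proj_point Y \<longleftrightarrow> (\<exists>c. c \<noteq> 0 \<and> X = c \<cdot>\<^sub>v Y)"
proof
  assume "proj_point X = proj_point Y"
  moreover have "X \<in> proj_point X"
    unfolding proj_point_def by (rule CollectI, rule exI[of _ 1]) simp
  ultimately show "\<exists>c. c \<noteq> 0 \<and> X = c \<cdot>\<^sub>v Y"
    by (auto simp: proj_point_def)
next
  assume "\<exists>c. c \<noteq> 0 \<and> X = c \<cdot>\<^sub>v Y"
  then obtain c where c: "c \<noteq> 0" "X = c \<cdot>\<^sub>v Y"
    by blast
  have "a \<cdot>\<^sub>v Y = (a / c) \<cdot>\<^sub>v X" for a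
    using c by (simp add: smult_smult_assoc)
  moreover have "a \<cdot>\<^sub>v X = (a * c) \<cdot>\<^sub>v Y" for a
    using c by (simp add: smult_smult_assoc)
  ultimately show "proj_point X = proj_point Y"
    unfolding proj_point_def using c(1)
    by (safe; metis divide_eq_0_iff mult_eq_0_iff)
qed

text \<open>Applying the transpose of \<open>D\<close> replaces the inverse \<open>A\<close>, known
  only implicitly, by the explicit action. The projective scalar is 1 because both vectors end in
  the coordinate 1.\<close>

lemma homog_eq_collineation_iff:
  assumes A: "is_inverse_mat (Suc m + 1) (Dmat (Suc m) i j) A"
    and x: "x \<in> carrier_vec (Suc m)" and y: "y \<in> carrier_vec (Suc m)"
  shows "homog y = collineation (Suc m) A (homog x) \<longleftrightarrow> x = affine_action m i j y"
proof -
  let ?D = "Dmat (Suc m) i j" and ?N = "Suc m + 1" and ?h = "\<lambda>x. x @\<^sub>v vec 1 (\<lambda>_. 1)"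
  have A': "A \<in> carrier_mat ?N ?N" "?D * A = 1\<^sub>m ?N" "A * ?D = 1\<^sub>m ?N"
    using A Dmat_carrier[of m i j] by (auto simp: is_inverse_mat_def inverts_mat_def)
  have hc: "?h z \<in> carrier_vec ?N" if "z \<in> carrier_vec (Suc m)" for z :: "'a vec"
    using that by (intro carrier_vecI) simp
  have last: "?h z $ Suc m = 1" if "z \<in> carrier_vec (Suc m)" for z :: "'a vec"
    using that by simp
  have AT: "transpose_mat A \<in> carrier_mat ?N ?N" and DT: "transpose_mat ?D \<in> carrier_mat ?N ?N"
    using A' Dmat_carrier[of m i j] by auto
  have "transpose_mat ?D * transpose_mat A = 1\<^sub>m ?N"
    using transpose_mult[OF A'(1) Dmat_carrier[of m i j]] A'(3) by simp
  then have DA: "transpose_mat ?D *\<^sub>v (transpose_mat A *\<^sub>v X) = X" if "X \<in> carrier_vec ?N" for X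
    using assoc_mult_mat_vec[OF DT AT that] that by simp
  have "transpose_mat A * transpose_mat ?D = 1\<^sub>m ?N"
    using transpose_mult[OF Dmat_carrier[of m i j] A'(1)] A'(2) by simp
  then have AD: "transpose_mat A *\<^sub>v (transpose_mat ?D *\<^sub>v X) = X" if "X \<in> carrier_vec ?N" for X
    using assoc_mult_mat_vec[OF AT DT that] that by simp
  have "?h x \<noteq> 0\<^sub>v ?N"
    using last[OF x] by (metis index_zero_vec(1) lessI one_neq_zero Suc_eq_plus1)
  then have "homog x \<in> PG (Suc m)"
    unfolding homog_def PG_def using hc[OF x] by blast
  then have "collineation (Suc m) A (homog x) = (\<lambda>X. transpose_mat A *\<^sub>v X) ` homog x"
    by (simp add: collineation_def)
  also have "\<dots> = {transpose_mat A *\<^sub>v (c \<cdot>\<^sub>v ?h x) | c. c \<noteq> 0}"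
    unfolding homog_def proj_point_def by blast
  also have "\<dots> = {c \<cdot>\<^sub>v (transpose_mat A *\<^sub>v ?h x) | c. c \<noteq> 0}"
    by (simp only: mult_mat_vec[OF AT hc[OF x]])
  also have "\<dots> = proj_point (transpose_mat A *\<^sub>v ?h x)"
    by (simp add: proj_point_def)
  finally have "homog y = collineation (Suc m) A (homog x) \<longleftrightarrow>
      (\<exists>c. c \<noteq> 0 \<and> ?h y = c \<cdot>\<^sub>v (transpose_mat A *\<^sub>v ?h x))"
    unfolding homog_def using hc[OF y] AT hc[OF x]
    by (simp only: proj_point_eq_iff[OF hc[OF y] mult_mat_vec_carrier[OF AT hc[OF x]]])
  also have "\<dots> \<longleftrightarrow> (\<exists>c. c \<noteq> 0 \<and> ?h (affine_action m i j y) = c \<cdot>\<^sub>v ?h x)"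
  proof -
    have "?h y = c \<cdot>\<^sub>v (transpose_mat A *\<^sub>v ?h x) \<longleftrightarrow> transpose_mat ?D *\<^sub>v ?h y = c \<cdot>\<^sub>v ?h x" for c
    proof
      assume "?h y = c \<cdot>\<^sub>v (transpose_mat A *\<^sub>v ?h x)"
      then show "transpose_mat ?D *\<^sub>v ?h y = c \<cdot>\<^sub>v ?h x"
        using mult_mat_vec[OF DT mult_mat_vec_carrier[OF AT hc[OF x]]] DA[OF hc[OF x]] by simp
    next
      assume "transpose_mat ?D *\<^sub>v ?h y = c \<cdot>\<^sub>v ?h x"
      then show "?h y = c \<cdot>\<^sub>v (transpose_mat A *\<^sub>v ?h x)"
        using mult_mat_vec[OF AT hc[OF x]] AD[OF hc[OF y]] by metis
    qed
    then show ?thesis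
      using Dmat_transpose_mult_homog[OF y] by simp
  qed
  also have "\<dots> \<longleftrightarrow> x = affine_action m i j y"
  proof
    assume "\<exists>c. c \<noteq> 0 \<and> ?h (affine_action m i j y) = c \<cdot>\<^sub>v ?h x"
    then obtain c where c: "?h (affine_action m i j y) = c \<cdot>\<^sub>v ?h x"
      by blast
    have "?h (affine_action m i j y) $ Suc m = c * ?h x $ Suc m"
      unfolding c by (rule index_smult_vec(1)) (use x in simp)
    then have "c = 1"
      using last[OF x] last[OF affine_action_carrier[of m i j y]] by simp
    then show "x = affine_action m i j y"
      using c append_vec_eq[OF affine_action_carrier[of m i j y] x] by simp
  qed (auto intro: exI[of _ 1])
  finally show ?thesis .
qed

lemma affine_image_collineation:
  assumes A: "is_inverse_mat (Suc m + 1) (Dmat (Suc m) i j) A"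
    and B: "B \<subseteq> AG (Suc m)"
  shows "affine_image (Suc m) (collineation (Suc m) A) B = {y \<in> AG (Suc m). affine_action m i j y \<in> B}"
proof -
  have "homog y \<in> collineation (Suc m) A ` homog ` B \<longleftrightarrow> affine_action m i j y \<in> B"
    if "y \<in> AG (Suc m)" for y
  proof -
    have "homog y \<in> collineation (Suc m) A ` homog ` B \<longleftrightarrow>
        (\<exists>x\<in>B. homog y = collineation (Suc m) A (homog x))"
      by blast
    also have "\<dots> \<longleftrightarrow> (\<exists>x\<in>B. x = affine_action m i j y)"
      using homog_eq_collineation_iff[OF A] B that by (intro bex_cong refl) (auto simp: AG_def)
    finally show ?thesis
      by simp
  qed
  then show ?thesis
    by (auto simp: affine_image_def)
qed

text \<open>Removes matrices from the description of blocks; every pair \<open>i\<close>,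
  \<open>j\<close> occurs because \<open>Dmat\<close> is always invertible.\<close>

lemma images_group_G:
  assumes "B \<subseteq> AG (Suc m)"
  shows "{affine_image (Suc m) g B | g. g \<in> group_G (Suc m)} =
    {{y \<in> AG (Suc m). affine_action m i j y \<in> B} | i j.
      i \<in> carrier_vec (Suc m) \<and> j \<in> carrier_vec m}"
proof (intro equalityI subsetI)
  fix C assume "C \<in> {affine_image (Suc m) g B | g. g \<in> group_G (Suc m)}"
  then obtain A i j where "i \<in> carrier_vec (Suc m)" "j \<in> carrier_vec m"
    "is_inverse_mat (Suc m + 1) (Dmat (Suc m) i j) A"
    "C = affine_image (Suc m) (collineation (Suc m) A) B"
    by (auto simp: group_G_def)
  then show "C \<in> {{y \<in> AG (Suc m). affine_action m i j y \<in> B} | i j.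
      i \<in> carrier_vec (Suc m) \<and> j \<in> carrier_vec m}"
    using affine_image_collineation[OF _ assms] by blast
next
  fix C assume "C \<in> {{y \<in> AG (Suc m). affine_action m i j y \<in> B} | i j.
      i \<in> carrier_vec (Suc m) \<and> j \<in> carrier_vec m}"
  then obtain i j where ij: "i \<in> carrier_vec (Suc m)" "j \<in> carrier_vec m"
    and C: "C = {y \<in> AG (Suc m). affine_action m i j y \<in> B}"
    by blast
  obtain A where A: "is_inverse_mat (Suc m + 1) (Dmat (Suc m) i j) A"
    by (rule is_inverse_mat_Dmat)
  have "collineation (Suc m) A \<in> group_G (Suc m)"
    unfolding group_G_def using ij A by (intro CollectI exI[of _ A] exI[of _ i] exI[of _ j]) simp
  then show "C \<in> {affine_image (Suc m) g B | g. g \<in> group_G (Suc m)}"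
    using C affine_image_collineation[OF A assms] by blast
qed

section \<open>Hermitian varieties as hyperplanes\<close>

context square_order_field
begin

text \<open>Polarisation of the norm, with \<open>y ^ q\<close> as the conjugate of
  \<open>y\<close>.\<close>

lemma norm_add: "(x + y :: 'a) ^ (q + 1) = x ^ (q + 1) + Tr (y ^ q * x) + y ^ (q + 1)"
  by (simp add: frob_add tr_def power_mult_distrib frob_frob algebra_simps)

text \<open>The \<open>Q\<close> of the overview; its zero set is the Hermitian variety.\<close>

definition qform :: "nat \<Rightarrow> 'a vec \<Rightarrow> 'a" where
  "qform m y = (\<Sum>s<m. (y $ s) ^ (q + 1)) + Tr (y $ m)"

lemma qform_in_K: "qform m y \<in> K"
  unfolding qform_def by (intro K_add K_sum norm_in_K Tr_in_K)

text \<open>The cross terms of the norms of \<open>y $ s + i $ s\<close> and the shear by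
  \<open>j\<close> are both traces of linear forms, so the group changes the quadratic form only by
  such a trace and a constant.\<close>

lemma qform_affine_action:
  "qform m (affine_action m i j y)
    = Tr (\<Sum>s<m. ((i $ s) ^ q + j $ s) * y $ s) + qform m y + qform m i"
proof -
  have "(\<Sum>s<m. (affine_action m i j y $ s) ^ (q + 1))
      = (\<Sum>s<m. (y $ s) ^ (q + 1) + Tr ((i $ s) ^ q * y $ s) + (i $ s) ^ (q + 1))"
    by (intro sum.cong refl) (simp only: norm_add[symmetric], simp add: affine_action_def)
  then show ?thesis
    by (simp add: qform_def affine_action_def Tr_add Tr_sum sum.distrib distrib_right algebra_simps)
qed

text \<open>Here \<open>d\<close> is the coefficient of the last coordinate of the corresponding
  hyperplane: 1 for images of the variety, 0 for images of the cones.\<close>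

definition quad_hyp :: "nat \<Rightarrow> 'a vec \<Rightarrow> 'a \<Rightarrow> 'a \<Rightarrow> 'a vec set" where
  "quad_hyp m b d c = {y \<in> AG (Suc m). Tr (\<Sum>s<m. b $ s * y $ s) + d * qform m y = c}"

lemma hermitian_variety_preimage:
  "{y \<in> AG (Suc m). affine_action m i j y \<in> hermitian_variety q (Suc m)}
    = quad_hyp m (vec m (\<lambda>s. (i $ s) ^ q + j $ s)) 1 (- qform m i)"
proof -
  have "hermitian_variety q (Suc m) = {x \<in> AG (Suc m). qform m x = 0}"
    by (simp add: hermitian_variety_def qform_def tr_def add.assoc)
  then show ?thesis
    using affine_action_carrier[of m i j]
    by (auto simp: quad_hyp_def AG_def qform_affine_action eq_neg_iff_add_eq_0)
qed

text \<open>The cone equation involves only the first \<open>m\<close> coordinates, which the group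
  translates by \<open>i\<close>, so only the constant changes.\<close>

lemma hermitian_cone_preimage:
  assumes "\<epsilon> \<noteq> 0" "\<epsilon> ^ q = - \<epsilon>" and \<omega>: "\<omega> \<in> carrier_vec m"
  shows "{y \<in> AG (Suc m). affine_action m i j y \<in> hermitian_cone q (Suc m) \<omega>}
    = quad_hyp m (\<epsilon> \<cdot>\<^sub>v \<omega>) 0 (- Tr (\<epsilon> * (\<Sum>s<m. \<omega> $ s * i $ s)))"
proof -
  have cone: "x \<in> hermitian_cone q (Suc m) \<omega> \<longleftrightarrow> Tr (\<epsilon> * (\<Sum>s<m. \<omega> $ s * x $ s)) = 0"
    if "x \<in> AG (Suc m)" for x
  proof -
    define u where "u = (\<Sum>s<m. \<omega> $ s * x $ s)"
    have "(\<Sum>s<m. (\<omega> $ s) ^ q * (x $ s) ^ q - \<omega> $ s * x $ s) = u ^ q - u"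
      by (simp add: u_def frob_sum sum_subtractf power_mult_distrib)
    moreover have "Tr (\<epsilon> * u) = - \<epsilon> * (u ^ q - u)"
      using assms(2) by (simp add: tr_def power_mult_distrib algebra_simps)
    ultimately show ?thesis
      using that assms(1) by (simp add: hermitian_cone_def u_def)
  qed
  have "(\<Sum>s<m. \<omega> $ s * affine_action m i j y $ s) = (\<Sum>s<m. \<omega> $ s * y $ s) + (\<Sum>s<m. \<omega> $ s * i $ s)" for y
    by (simp add: affine_action_def distrib_left sum.distrib)
  moreover have "(\<Sum>s<m. (\<epsilon> \<cdot>\<^sub>v \<omega>) $ s * y $ s) = \<epsilon> * (\<Sum>s<m. \<omega> $ s * y $ s)" for y
    using \<omega> by (simp add: sum_distrib_left mult.assoc)
  ultimately show ?thesis
    using affine_action_carrier[of m i j]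
    by (auto simp: quad_hyp_def AG_def cone[unfolded AG_def] distrib_left Tr_add eq_neg_iff_add_eq_0)
qed

lemma images_hermitian_variety:
  "{affine_image (Suc m) g (hermitian_variety q (Suc m)) | g. g \<in> group_G (Suc m)}
    = {quad_hyp m b 1 c | b c. b \<in> carrier_vec m \<and> c \<in> K}" (is "?L = ?R")
proof -
  have sub: "(hermitian_variety q (Suc m) :: 'a vec set) \<subseteq> AG (Suc m)"
    by (auto simp: hermitian_variety_def)
  have L: "?L = {quad_hyp m (vec m (\<lambda>s. (i $ s) ^ q + j $ s)) 1 (- qform m i) | i j.
      i \<in> carrier_vec (Suc m) \<and> j \<in> carrier_vec m}"
    by (simp only: images_group_G[OF sub] hermitian_variety_preimage)
  show ?thesis
    unfolding L
  proof (intro equalityI subsetI)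
    fix B assume "B \<in> {quad_hyp m (vec m (\<lambda>s. (i $ s) ^ q + j $ s)) 1 (- qform m i) | i j.
      i \<in> carrier_vec (Suc m) \<and> j \<in> carrier_vec m}"
    then show "B \<in> ?R"
      using K_uminus[OF qform_in_K] vec_carrier by blast
  next
    fix B assume "B \<in> ?R"
    then obtain b c where b: "b \<in> carrier_vec m" and c: "c \<in> K" and B: "B = quad_hyp m b 1 c"
      by blast
    obtain t where t: "Tr t = - c"
      using Tr_surj[OF K_uminus[OF c]] .
    \<comment> \<open>With \<open>i\<close> supported on the last coordinate, the choice
      \<open>j = b\<close> gives the linear part exactly, and \<open>t\<close> alone sets the
      constant.\<close>
    define i where "i = vec (Suc m) (\<lambda>k. if k = m then t else 0)"
    have "vec m (\<lambda>s. (i $ s) ^ q + b $ s) = b"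
      using b q_gt_1 by (intro eq_vecI) (auto simp: i_def)
    moreover have "- qform m i = c"
      using t by (simp add: qform_def i_def)
    ultimately have "B = quad_hyp m (vec m (\<lambda>s. (i $ s) ^ q + b $ s)) 1 (- qform m i)"
      using B by simp
    moreover have "i \<in> carrier_vec (Suc m)"
      by (simp add: i_def)
    ultimately show "B \<in> {quad_hyp m (vec m (\<lambda>s. (i $ s) ^ q + j $ s)) 1 (- qform m i) | i j.
      i \<in> carrier_vec (Suc m) \<and> j \<in> carrier_vec m}"
      using b by blast
  qed
qed

lemma images_hermitian_cones:
  "{affine_image (Suc m) g (hermitian_cone q (Suc m) \<omega>) | g \<omega>.
      g \<in> group_G (Suc m) \<and> \<omega> \<in> carrier_vec m \<and> \<omega> \<noteq> 0\<^sub>v m}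
    = {quad_hyp m b 0 c | b c. b \<in> carrier_vec m \<and> b \<noteq> 0\<^sub>v m \<and> c \<in> K}" (is "?L = ?R")
proof -
  obtain \<epsilon> :: 'a where \<epsilon>: "\<epsilon> \<noteq> 0" "\<epsilon> ^ q = - \<epsilon>"
    by (rule trace_zero_element)
  have sub: "hermitian_cone q (Suc m) \<omega> \<subseteq> AG (Suc m)" for \<omega> :: "'a vec"
    by (auto simp: hermitian_cone_def)
  have L: "?L = (\<Union>\<omega> \<in> carrier_vec m - {0\<^sub>v m}. {quad_hyp m (\<epsilon> \<cdot>\<^sub>v \<omega>) 0
      (- Tr (\<epsilon> * (\<Sum>s<m. \<omega> $ s * i $ s))) | i j. i \<in> carrier_vec (Suc m) \<and> j \<in> (carrier_vec m :: 'a vec set)})"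
  proof -
    have "?L = (\<Union>\<omega> \<in> carrier_vec m - {0\<^sub>v m}.
        {affine_image (Suc m) g (hermitian_cone q (Suc m) \<omega>) | g. g \<in> group_G (Suc m)})"
      by blast
    also have "\<dots> = (\<Union>\<omega> \<in> carrier_vec m - {0\<^sub>v m}. {quad_hyp m (\<epsilon> \<cdot>\<^sub>v \<omega>) 0
      (- Tr (\<epsilon> * (\<Sum>s<m. \<omega> $ s * i $ s))) | i j. i \<in> carrier_vec (Suc m) \<and> j \<in> (carrier_vec m :: 'a vec set)})"
    proof (rule SUP_cong)
      fix \<omega> :: "'a vec" assume "\<omega> \<in> carrier_vec m - {0\<^sub>v m}"
      then have "\<omega> \<in> carrier_vec m" by simp
      then show "{affine_image (Suc m) g (hermitian_cone q (Suc m) \<omega>) | g. g \<in> group_G (Suc m)}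
        = {quad_hyp m (\<epsilon> \<cdot>\<^sub>v \<omega>) 0 (- Tr (\<epsilon> * (\<Sum>s<m. \<omega> $ s * i $ s))) | i j.
            i \<in> carrier_vec (Suc m) \<and> j \<in> (carrier_vec m :: 'a vec set)}"
        by (simp only: images_group_G[OF sub] hermitian_cone_preimage[OF \<epsilon>])
    qed simp
    finally show ?thesis .
  qed
  have nz: "a \<cdot>\<^sub>v \<omega> \<noteq> 0\<^sub>v m" if "a \<noteq> 0" "\<omega> \<in> carrier_vec m" "\<omega> \<noteq> 0\<^sub>v m" for a and \<omega> :: "'a vec"
  proof
    assume eq: "a \<cdot>\<^sub>v \<omega> = 0\<^sub>v m"
    have "\<omega> $ s = 0" if "s < m" for s
      using arg_cong[OF eq, of "\<lambda>v. v $ s"] that \<open>a \<noteq> 0\<close> \<open>\<omega> \<in> carrier_vec m\<close> by simp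
    then have "\<omega> = 0\<^sub>v m"
      using that(2) by (intro eq_vecI) auto
    with that(3) show False by simp
  qed
  show ?thesis
    unfolding L
  proof (intro equalityI subsetI)
    fix B assume "B \<in> (\<Union>\<omega> \<in> carrier_vec m - {0\<^sub>v m}. {quad_hyp m (\<epsilon> \<cdot>\<^sub>v \<omega>) 0
      (- Tr (\<epsilon> * (\<Sum>s<m. \<omega> $ s * i $ s))) | i j. i \<in> carrier_vec (Suc m) \<and> j \<in> (carrier_vec m :: 'a vec set)})"
    then obtain \<omega> i where \<omega>: "\<omega> \<in> carrier_vec m" "\<omega> \<noteq> 0\<^sub>v m"
      and B: "B = quad_hyp m (\<epsilon> \<cdot>\<^sub>v \<omega>) 0 (- Tr (\<epsilon> * (\<Sum>s<m. \<omega> $ s * i $ s)))"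
      by blast
    have "\<epsilon> \<cdot>\<^sub>v \<omega> \<in> carrier_vec m" "\<epsilon> \<cdot>\<^sub>v \<omega> \<noteq> 0\<^sub>v m"
      using \<omega> nz \<epsilon>(1) by auto
    then show "B \<in> ?R"
      using B K_uminus[OF Tr_in_K] by blast
  next
    fix B assume "B \<in> ?R"
    then obtain b c where b: "b \<in> carrier_vec m" "b \<noteq> 0\<^sub>v m" and c: "c \<in> K" and B: "B = quad_hyp m b 0 c"
      by blast
    \<comment> \<open>Undoes the factor \<open>\<epsilon>\<close> by which the cone equation becomes
      a trace equation.\<close>
    define \<omega> where "\<omega> = (1 / \<epsilon>) \<cdot>\<^sub>v b"
    have \<omega>: "\<omega> \<in> carrier_vec m" "\<omega> \<noteq> 0\<^sub>v m" "\<epsilon> \<cdot>\<^sub>v \<omega> = b"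
      using b nz[of "1 / \<epsilon>" b] \<epsilon>(1) by (auto simp: \<omega>_def smult_smult_assoc)
    obtain t where t: "Tr t = - c"
      using Tr_surj[OF K_uminus[OF c]] .
    obtain r where r: "r < m" "b $ r \<noteq> 0"
      using b by (metis carrier_vecD eq_vecI index_zero_vec)
    \<comment> \<open>One non-zero coefficient of \<open>b\<close> suffices: this translation makes
      the linear form equal to \<open>t\<close>, so every constant in \<open>K\<close> is
      reached.\<close>
    define i where "i = vec (Suc m) (\<lambda>k. if k = r then t / b $ r else 0)"
    have "\<epsilon> * (\<Sum>s<m. \<omega> $ s * i $ s) = (\<Sum>s<m. b $ s * i $ s)"
      using \<omega>(1) by (simp add: \<omega>(3)[symmetric] sum_distrib_left mult.assoc)
    also have "\<dots> = (\<Sum>s<m. if s = r then t else 0)"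
      using r by (intro sum.cong) (auto simp: i_def)
    finally have "- Tr (\<epsilon> * (\<Sum>s<m. \<omega> $ s * i $ s)) = c"
      using t r by simp
    then have "B = quad_hyp m (\<epsilon> \<cdot>\<^sub>v \<omega>) 0 (- Tr (\<epsilon> * (\<Sum>s<m. \<omega> $ s * i $ s)))"
      using B \<omega>(3) by simp
    moreover have "i \<in> carrier_vec (Suc m)"
      by (simp add: i_def)
    ultimately show "B \<in> (\<Union>\<omega> \<in> carrier_vec m - {0\<^sub>v m}. {quad_hyp m (\<epsilon> \<cdot>\<^sub>v \<omega>) 0
      (- Tr (\<epsilon> * (\<Sum>s<m. \<omega> $ s * i $ s))) | i j. i \<in> carrier_vec (Suc m) \<and> j \<in> (carrier_vec m :: 'a vec set)})"
      using \<omega>(1,2) b(1) by blast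
  qed
qed

section \<open>Orbits of \<open>N\<close> as fibres of a map onto the points of the affine space
  over \<open>K\<close>\<close>

lemma N_orbit_eq:
  assumes x: "x \<in> AG (Suc m)"
  shows "N_orbit q (Suc m) x
    = {y \<in> AG (Suc m). (\<forall>s<m. y $ s = x $ s) \<and> Tr (y $ m) = Tr (x $ m)}"
proof -
  have "(\<exists>g\<in>group_N q (Suc m). homog y = g (homog x)) \<longleftrightarrow>
      (\<forall>s<m. y $ s = x $ s) \<and> Tr (y $ m) = Tr (x $ m)" if y: "y \<in> AG (Suc m)" for y
  proof
    assume "\<exists>g\<in>group_N q (Suc m). homog y = g (homog x)"
    then obtain A i where i: "\<forall>s<m. i $ s = 0" "i $ m \<in> T0 q"
      and A: "is_inverse_mat (Suc m + 1) (Dmat (Suc m) i (0\<^sub>v m)) A"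
      and eq: "homog y = collineation (Suc m) A (homog x)"
      by (auto simp: group_N_def)
    have "x = affine_action m i (0\<^sub>v m) y"
      using eq homog_eq_collineation_iff[OF A] x y by (simp add: AG_def)
    then show "(\<forall>s<m. y $ s = x $ s) \<and> Tr (y $ m) = Tr (x $ m)"
      using i by (simp add: affine_action_def T0_def Tr_add)
  next
    assume eq: "(\<forall>s<m. y $ s = x $ s) \<and> Tr (y $ m) = Tr (x $ m)"
    \<comment> \<open>The translation leads from \<open>y\<close> to \<open>x\<close>, since
      \<open>affine_action\<close> inverts the collineation; equal traces put the difference into
      \<open>T0\<close>.\<close>
    define i where "i = vec (Suc m) (\<lambda>k. if k = m then x $ m - y $ m else 0)"
    obtain A where A: "is_inverse_mat (Suc m + 1) (Dmat (Suc m) i (0\<^sub>v m)) A"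
      by (rule is_inverse_mat_Dmat)
    have "x = affine_action m i (0\<^sub>v m) y"
      using x eq by (intro eq_vecI) (auto simp: affine_action_def i_def AG_def)
    then have "homog y = collineation (Suc m) A (homog x)"
      using homog_eq_collineation_iff[OF A] x y by (simp add: AG_def)
    moreover have "i \<in> carrier_vec (Suc m)" "\<forall>s<m. i $ s = 0" "i $ m \<in> T0 q"
      using eq by (auto simp: i_def T0_def Tr_diff)
    then have "collineation (Suc m) A \<in> group_N q (Suc m)"
      unfolding group_N_def using A by (intro CollectI exI[of _ A] exI[of _ i]) simp
    ultimately show "\<exists>g\<in>group_N q (Suc m). homog y = g (homog x)"
      by blast
  qed
  then show ?thesis
    by (auto simp: N_orbit_def)
qed

text \<open>The \<open>K\<close>-coordinates of \<open>y\<^sub>s\<close> are its traces against the basis \<open>1, \<beta>\<close>; with the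
  coefficients of \<open>pair_coords\<close> below, \<open>K\<close>-linear forms become \<open>y \<mapsto> Tr (\<Sum>\<^sub>s b\<^sub>s y\<^sub>s)\<close>.\<close>

definition \<Psi> :: "'a \<Rightarrow> nat \<Rightarrow> 'a vec \<Rightarrow> 'a vec" where
  "\<Psi> \<beta> m y = vec (2 * m + 1) (\<lambda>k. if k = 2 * m then qform m y
     else Tr ((if even k then 1 else \<beta>) * y $ (k div 2)))"

lemma \<Psi>_AGq: "\<Psi> \<beta> m y \<in> AGq_points q (2 * m + 1)"
  by (rule AGq_pointsI) (auto simp: \<Psi>_def qform_in_K Tr_in_K)

lemma \<Psi>_index:
  "s < m \<Longrightarrow> \<Psi> \<beta> m y $ (2 * s) = Tr (y $ s)"
  "s < m \<Longrightarrow> \<Psi> \<beta> m y $ (2 * s + 1) = Tr (\<beta> * y $ s)"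
  "\<Psi> \<beta> m y $ (2 * m) = qform m y"
  by (auto simp: \<Psi>_def)

text \<open>The trace pairs determine the first \<open>m\<close> entries; then the norm sums agree,
  and the last coordinate retains just the trace of \<open>y $ m\<close>.\<close>

lemma \<Psi>_eq_iff:
  assumes \<beta>: "\<beta> \<notin> K"
  shows "\<Psi> \<beta> m y = \<Psi> \<beta> m x \<longleftrightarrow> (\<forall>s<m. y $ s = x $ s) \<and> Tr (y $ m) = Tr (x $ m)"
proof
  assume eq: "\<Psi> \<beta> m y = \<Psi> \<beta> m x"
  have "y $ s = x $ s" if "s < m" for s
  proof -
    have "(Tr (y $ s), Tr (\<beta> * y $ s)) = (Tr (x $ s), Tr (\<beta> * x $ s))"
      using \<Psi>_index(1,2)[OF that, of \<beta>] eq by metis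
    then show ?thesis
      using bij_betw_imp_inj_on[OF trace_coordinates[OF \<beta>]] by (auto dest: injD)
  qed
  moreover from this have "Tr (y $ m) = Tr (x $ m)"
    using \<Psi>_index(3)[of \<beta> m] eq by (metis (no_types, lifting) add_left_cancel lessThan_iff qform_def sum.cong)
  ultimately show "(\<forall>s<m. y $ s = x $ s) \<and> Tr (y $ m) = Tr (x $ m)"
    by blast
next
  assume eq: "(\<forall>s<m. y $ s = x $ s) \<and> Tr (y $ m) = Tr (x $ m)"
  then have "qform m y = qform m x"
    by (simp add: qform_def)
  with eq show "\<Psi> \<beta> m y = \<Psi> \<beta> m x"
    by (intro eq_vecI) (auto simp: \<Psi>_def)
qed

text \<open>The paired coordinates prescribe the first \<open>m\<close> entries. What the last
  coordinate still requires after subtracting their norms lies in \<open>K\<close> and is therefore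
  a trace.\<close>

lemma \<Psi>_surj:
  assumes \<beta>: "\<beta> \<notin> K"
  shows "\<Psi> \<beta> m ` AG (Suc m) = AGq_points q (2 * m + 1)"
proof (intro equalityI subsetI)
  fix w :: "'a vec" assume w: "w \<in> AGq_points q (2 * m + 1)"
  have "\<exists>t. Tr t = w $ (2 * s) \<and> Tr (\<beta> * t) = w $ (2 * s + 1)" if "s < m" for s
  proof -
    have "(w $ (2 * s), w $ (2 * s + 1)) \<in> K \<times> K"
      using AGq_index[OF w] that by simp
    then have "(w $ (2 * s), w $ (2 * s + 1)) \<in> range (\<lambda>t. (Tr t, Tr (\<beta> * t)))"
      by (simp only: bij_betw_imp_surj_on[OF trace_coordinates[OF \<beta>]])
    then show ?thesis
      by force
  qed
  then obtain t where t: "\<And>s. s < m \<Longrightarrow> Tr (t s) = w $ (2 * s) \<and> Tr (\<beta> * t s) = w $ (2 * s + 1)"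
    by metis
  have "w $ (2 * m) - (\<Sum>s<m. t s ^ (q + 1)) \<in> K"
    using AGq_index[OF w, of "2 * m"] by (intro K_diff K_sum norm_in_K) simp
  then obtain z where z: "Tr z = w $ (2 * m) - (\<Sum>s<m. t s ^ (q + 1))"
    by (rule Tr_surj)
  define y where "y = vec (Suc m) (\<lambda>k. if k = m then z else t k)"
  have qf: "qform m y = w $ (2 * m)"
    using z by (simp add: qform_def y_def)
  have "\<Psi> \<beta> m y = w"
  proof (rule eq_vecI)
    fix k assume "k < dim_vec w"
    then have "k < 2 * m + 1"
      using AGq_carrier[OF w] by simp
    then show "\<Psi> \<beta> m y $ k = w $ k"
    proof (cases rule: less_double_Suc_cases)
      case (1 s)
      then show ?thesis using \<Psi>_index(1)[of s m] t by (simp add: y_def)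
    next
      case (2 s)
      then show ?thesis using \<Psi>_index(2)[of s m] t by (simp add: y_def)
    next
      case 3
      then show ?thesis using \<Psi>_index(3) qf by simp
    qed
  qed (use AGq_carrier[OF w] in \<open>simp add: \<Psi>_def\<close>)
  moreover have "y \<in> AG (Suc m)"
    by (simp add: y_def AG_def)
  ultimately show "w \<in> \<Psi> \<beta> m ` AG (Suc m)"
    by blast
qed (use \<Psi>_AGq in blast)

definition pair_coords :: "'a \<Rightarrow> nat \<Rightarrow> 'a vec \<Rightarrow> 'a vec" where
  "pair_coords \<beta> m a = vec m (\<lambda>s. a $ (2 * s) + a $ (2 * s + 1) * \<beta>)"

text \<open>By \<open>K\<close>-linearity of the trace, the two coefficients attached to
  \<open>y $ s\<close> merge into a single field coefficient.\<close>

lemma scalar_prod_\<Psi>: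
  assumes a: "a \<in> AGq_points q (2 * m + 1)"
  shows "a \<bullet> \<Psi> \<beta> m y = Tr (\<Sum>s<m. pair_coords \<beta> m a $ s * y $ s) + a $ (2 * m) * qform m y"
proof -
  have "a \<bullet> \<Psi> \<beta> m y = (\<Sum>k<2 * m + 1. a $ k * \<Psi> \<beta> m y $ k)"
    by (simp add: scalar_prod_def \<Psi>_def atLeast0LessThan)
  also have "\<dots> = (\<Sum>s<m. a $ (2 * s) * \<Psi> \<beta> m y $ (2 * s) + a $ (2 * s + 1) * \<Psi> \<beta> m y $ (2 * s + 1))
      + a $ (2 * m) * \<Psi> \<beta> m y $ (2 * m)"
    by (rule sum_lessThan_double)
  also have "(\<Sum>s<m. a $ (2 * s) * \<Psi> \<beta> m y $ (2 * s) + a $ (2 * s + 1) * \<Psi> \<beta> m y $ (2 * s + 1))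
      = (\<Sum>s<m. Tr (pair_coords \<beta> m a $ s * y $ s))"
  proof (intro sum.cong refl)
    fix s assume "s \<in> {..<m}"
    then have s: "s < m" by simp
    have K: "a $ (2 * s) \<in> K" "a $ (2 * s + 1) \<in> K"
      using AGq_index[OF a] s by simp_all
    have "pair_coords \<beta> m a $ s * y $ s = a $ (2 * s) * y $ s + a $ (2 * s + 1) * (\<beta> * y $ s)"
      using s by (simp add: pair_coords_def algebra_simps)
    then show "a $ (2 * s) * \<Psi> \<beta> m y $ (2 * s) + a $ (2 * s + 1) * \<Psi> \<beta> m y $ (2 * s + 1)
        = Tr (pair_coords \<beta> m a $ s * y $ s)"
      unfolding \<Psi>_index(1,2)[OF s] by (simp only: Tr_add Tr_mult_K[OF K(1)] Tr_mult_K[OF K(2)])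
  qed
  finally show ?thesis
    by (simp only: Tr_sum \<Psi>_index(3))
qed

lemma pair_coords_eq_0:
  assumes \<beta>: "\<beta> \<notin> K" and a: "a \<in> AGq_points q (2 * m + 1)"
  shows "pair_coords \<beta> m a = 0\<^sub>v m \<and> a $ (2 * m) = 0 \<longleftrightarrow> a = 0\<^sub>v (2 * m + 1)"
proof
  assume eq: "pair_coords \<beta> m a = 0\<^sub>v m \<and> a $ (2 * m) = 0"
  have zero: "a $ (2 * s) = 0 \<and> a $ (2 * s + 1) = 0" if s: "s < m" for s
  proof -
    have "pair_coords \<beta> m a $ s = 0"
      using eq s by simp
    then have "a $ (2 * s) + a $ (2 * s + 1) * \<beta> = 0 + 0 * \<beta>"
      using s by (simp add: pair_coords_def)
    moreover have "a $ (2 * s) \<in> K" "a $ (2 * s + 1) \<in> K"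
      using AGq_index[OF a] s by simp_all
    ultimately show ?thesis
      using inj_onD[OF bij_betw_imp_inj_on[OF K_basis[OF \<beta>]],
          of "(a $ (2 * s), a $ (2 * s + 1))" "(0, 0)"] K_0 by simp
  qed
  show "a = 0\<^sub>v (2 * m + 1)"
  proof (rule eq_vecI)
    fix k assume "k < dim_vec (0\<^sub>v (2 * m + 1) :: 'a vec)"
    then have k: "k < 2 * m + 1" by simp
    then have "a $ k = 0"
      using zero eq by (cases rule: less_double_Suc_cases) auto
    then show "a $ k = 0\<^sub>v (2 * m + 1) $ k"
      using k by simp
  qed (use AGq_carrier[OF a] in simp)
next
  assume "a = 0\<^sub>v (2 * m + 1)"
  then show "pair_coords \<beta> m a = 0\<^sub>v m \<and> a $ (2 * m) = 0"
    by (auto simp: pair_coords_def)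
qed

lemma pair_coords_surj:
  assumes \<beta>: "\<beta> \<notin> K" and b: "b \<in> carrier_vec m" and d: "d \<in> K"
  obtains a where "a \<in> AGq_points q (2 * m + 1)" "pair_coords \<beta> m a = b" "a $ (2 * m) = d"
proof -
  \<comment> \<open>Every field element has an expansion in \<open>1, \<beta>\<close>, so
    \<open>u\<close> and \<open>v\<close> can be chosen for all indices at once.\<close>
  have "\<exists>u v. u \<in> K \<and> v \<in> K \<and> b $ s = u + v * \<beta>" for s
    using bij_betw_imp_surj_on[OF K_basis[OF \<beta>]] by (force simp: image_iff)
  then obtain u v where uv: "\<And>s. u s \<in> K" "\<And>s. v s \<in> K" "\<And>s. b $ s = u s + v s * \<beta>"
    by metis
  define a where "a = vec (2 * m + 1) (\<lambda>k. if k = 2 * m then d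
    else if even k then u (k div 2) else v (k div 2))"
  have "a \<in> AGq_points q (2 * m + 1)"
    by (rule AGq_pointsI) (auto simp: a_def uv d)
  moreover have "pair_coords \<beta> m a = b"
    using b by (intro eq_vecI) (auto simp: pair_coords_def a_def uv(3))
  moreover have "a $ (2 * m) = d"
    by (simp add: a_def)
  ultimately show thesis
    by (rule that)
qed

text \<open>Normalises the quadratic coefficient to 1; the factor \<open>1 / d\<close> passes
  through the trace because it lies in \<open>K\<close>.\<close>

lemma quad_hyp_divide:
  assumes "d \<in> K" "d \<noteq> 0" "b \<in> carrier_vec m"
  shows "quad_hyp m b d c = quad_hyp m ((1 / d) \<cdot>\<^sub>v b) 1 (c / d)"
proof -
  have "Tr (\<Sum>s<m. ((1 / d) \<cdot>\<^sub>v b) $ s * y $ s) = Tr (\<Sum>s<m. b $ s * y $ s) / d" for y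
  proof -
    have "(\<Sum>s<m. ((1 / d) \<cdot>\<^sub>v b) $ s * y $ s) = (1 / d) * (\<Sum>s<m. b $ s * y $ s)"
      using assms(3) by (simp add: sum_distrib_left)
    then show ?thesis
      using Tr_mult_K[OF K_divide[OF K_1 assms(1)]] by simp
  qed
  moreover have "t + d * z = c \<longleftrightarrow> t / d + 1 * z = c / d" for t z
    using assms(2) by (auto simp: divide_simps mult.commute)
  ultimately show ?thesis
    by (simp add: quad_hyp_def)
qed

section \<open>Blocks as preimages of hyperplanes, and the isomorphism\<close>

lemma \<Psi>_preimage_hyperplane:
  assumes "a \<in> AGq_points q (2 * m + 1)"
  shows "{y \<in> AG (Suc m). \<Psi> \<beta> m y \<in> {x \<in> AGq_points q (2 * m + 1). a \<bullet> x = c}}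
    = quad_hyp m (pair_coords \<beta> m a) (a $ (2 * m)) c"
  by (simp only: quad_hyp_def mem_Collect_eq scalar_prod_\<Psi>[OF assms] \<Psi>_AGq simp_thms)

text \<open>The last coefficient \<open>d\<close> of the normal separates the two families:
  \<open>d \<noteq> 0\<close> is normalised to 1, and \<open>d = 0\<close> forces the remaining
  coefficients to be non-zero.\<close>

lemma \<Psi>_preimages_hyperplanes:
  assumes \<beta>: "\<beta> \<notin> K"
  shows "(\<lambda>H. {y \<in> AG (Suc m). \<Psi> \<beta> m y \<in> H}) ` AGq_hyperplanes q (2 * m + 1)
    = {quad_hyp m b 1 c | b c. b \<in> carrier_vec m \<and> c \<in> K} \<union>
      {quad_hyp m b 0 c | b c. b \<in> carrier_vec m \<and> b \<noteq> 0\<^sub>v m \<and> c \<in> K}" (is "?L = ?R")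
proof (intro equalityI subsetI)
  fix B assume "B \<in> ?L"
  then obtain a c where a: "a \<in> AGq_points q (2 * m + 1)" "a \<noteq> 0\<^sub>v (2 * m + 1)" and c: "c \<in> K"
    and B: "B = {y \<in> AG (Suc m). \<Psi> \<beta> m y \<in> {x \<in> AGq_points q (2 * m + 1). a \<bullet> x = c}}"
    unfolding AGq_hyperplanes_def by blast
  define b d where "b = pair_coords \<beta> m a" and "d = a $ (2 * m)"
  have B: "B = quad_hyp m b d c"
    unfolding B b_def d_def by (rule \<Psi>_preimage_hyperplane[OF a(1)])
  have b: "b \<in> carrier_vec m"
    by (simp add: b_def pair_coords_def)
  have d: "d \<in> K"
    using AGq_index[OF a(1)] by (simp add: d_def)
  show "B \<in> ?R"
  proof (cases "d = 0")
    case True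
    then have "b \<noteq> 0\<^sub>v m"
      using pair_coords_eq_0[OF \<beta> a(1)] a(2) by (simp add: b_def d_def)
    then show ?thesis
      using B True b c by blast
  next
    case False
    have "(1 / d) \<cdot>\<^sub>v b \<in> carrier_vec m"
      using b by simp
    then show ?thesis
      unfolding B quad_hyp_divide[OF d False b] using K_divide[OF c d] by blast
  qed
next
  fix B assume "B \<in> ?R"
  \<comment> \<open>Both families are treated together, with \<open>d\<close> equal to 1 or
    0.\<close>
  then obtain b d c where b: "b \<in> carrier_vec m" and d: "d \<in> K" and c: "c \<in> K"
    and nz: "b \<noteq> 0\<^sub>v m \<or> d \<noteq> 0" and B: "B = quad_hyp m b d c"
  proof -
    from \<open>B \<in> ?R\<close> consider b c where "b \<in> carrier_vec m" "c \<in> K" "B = quad_hyp m b 1 c"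
      | b c where "b \<in> carrier_vec m" "b \<noteq> 0\<^sub>v m" "c \<in> K" "B = quad_hyp m b 0 c"
      by blast
    then show thesis
      by cases (use that K_0 K_1 zero_neq_one in metis)+
  qed
  obtain a where a: "a \<in> AGq_points q (2 * m + 1)" "pair_coords \<beta> m a = b" "a $ (2 * m) = d"
    using pair_coords_surj[OF \<beta> b d] .
  then have "a \<noteq> 0\<^sub>v (2 * m + 1)"
    using pair_coords_eq_0[OF \<beta> a(1)] nz by auto
  then have "{x \<in> AGq_points q (2 * m + 1). a \<bullet> x = c} \<in> AGq_hyperplanes q (2 * m + 1)"
    unfolding AGq_hyperplanes_def using a(1) c by blast
  moreover have "B = {y \<in> AG (Suc m). \<Psi> \<beta> m y \<in> {x \<in> AGq_points q (2 * m + 1). a \<bullet> x = c}}"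
    unfolding \<Psi>_preimage_hyperplane[OF a(1)] using a B by simp
  ultimately show "B \<in> ?L"
    by blast
qed

text \<open>Any \<open>\<beta>\<close> outside \<open>K\<close> yields an isomorphism: points are
  the fibres of \<open>\<Psi>\<close> and blocks the preimages of hyperplanes. The argument is
  uniform in \<open>q\<close>.\<close>

lemma isomorphic_S_struct_AGq:
  "isomorphic (S_struct q (Suc m) :: ('a vec set, 'a vec set) inc_struct)
    (AGq_design q (2 * m + 1) :: ('a vec, 'a vec set) inc_struct)"
proof -
  obtain \<beta> where \<beta>: "\<beta> \<notin> K"
    by (rule not_in_K)
  have "points (S_struct q (Suc m)) = (\<lambda>x. {y \<in> AG (Suc m). \<Psi> \<beta> m y = \<Psi> \<beta> m x}) ` AG (Suc m)"
    by (simp add: S_struct_def N_orbit_eq \<Psi>_eq_iff[OF \<beta>])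
  moreover have "blocks (S_struct q (Suc m)) =
      (\<lambda>H. {y \<in> AG (Suc m). \<Psi> \<beta> m y \<in> H}) ` AGq_hyperplanes q (2 * m + 1)"
    unfolding \<Psi>_preimages_hyperplanes[OF \<beta>] images_hermitian_variety[symmetric]
      images_hermitian_cones[symmetric]
    by (simp add: S_struct_def)
  ultimately show ?thesis
    using \<Psi>_surj[OF \<beta>, of m]
    by (intro isomorphic_pullback[where X = "AG (Suc m)" and \<Psi> = "\<Psi> \<beta> m"])
      (auto simp: AGq_design_def S_struct_def AGq_hyperplanes_def)
qed

end

theorem theorem4p1:
  fixes q n :: nat
  assumes "primepow q"
    and "card (UNIV :: 'a::{field, finite} set) = q ^ 2"
    and "n \<ge> 2"
  shows "affine_two_design (S_struct q n :: ('a vec set, 'a vec set) inc_struct)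
           (q ^ (2 * n - 1)) (q ^ (2 * (n - 1))) (\<Sum>s\<le>2 * n - 3. q ^ s) (q ^ (2 * n - 3)) \<and>
         (q > 2 \<longrightarrow>
           isomorphic (S_struct q n :: ('a vec set, 'a vec set) inc_struct)
             (AGq_design q (2 * n - 1) :: ('a vec, 'a vec set) inc_struct))"
proof -
  interpret square_order_field q "TYPE('a)"
    by (rule square_order_field.intro) (fact assms)+
  obtain m where n: "n = Suc m"
    using assms(3) by (cases n) auto
  \<comment> \<open>With \<open>n = Suc m\<close> the dimension over \<open>K\<close> is
    \<open>2 * m + 1\<close>; the exponents are put in the form in which the affine space provides
    them.\<close>
  have eqs: "2 * n - 1 = 2 * m + 1" "2 * (n - 1) = 2 * m + 1 - 1" "2 * n - 3 = 2 * m + 1 - 2"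
    using n by simp_all
  have "2 * m + 1 \<ge> 2"
    using assms(3) n by simp
  show ?thesis
    unfolding eqs unfolding n
    using isomorphic_S_struct_AGq affine_two_design_isomorphic[OF isomorphic_S_struct_AGq
        affine_two_design_AGq[OF \<open>2 * m + 1 \<ge> 2\<close>]]
    by blast
qed

end
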